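(* Let $G$ be an irreducible discrete subgroup of $\mathrm{PU}(2,1)$. Then $G$ is $\mathbb{R}$-Fuchsian if and only if the invariant trace field $k(G)$ of $G$ is real (i.e. $k(G)\subset\mathbb{R}$).
   Context: Let $V=\mathbb{C}^{3}$ with the Hermitian form $\langle z,w\rangle=z_1\bar w_3+z_2\bar w_2+z_3\bar w_1$ of signature $(2,1)$. $\mathrm{SU}(2,1)$ is the group of $3\times 3$ complex matrices of determinant $1$ preserving this form, $\mathrm{PU}(2,1)$ is the corresponding projective unitary group, and $\pi:\mathrm{SU}(2,1)\to\mathrm{PU}(2,1)$ is the natural projection (surjective, with kernel the scalar matrices given by the cube roots of unity). The complex hyperbolic plane $\mathbf{H}^2_{\mathbb{C}}\subset\mathbb{P}(V)$ is the set of projective classes of vectors $v$ with $\langle v,v\rangle<0$; $\mathrm{PU}(2,1)$ acts on it. A totally real geodesic 2-plane is the image under an element of $\mathrm{PU}(2,1)$ of $\mathbb{P}(\mathbb{R}^3\setminus\{0\})\cap\mathbf{H}^2_{\mathbb{C}}$, where $\mathbb{R}^3\subset V$ is the set of vectors with real coordinates. A subgroup $G$ of $\mathrm{PU}(2,1)$ is reducible if all its elements have a common fixed point in $\mathbb{P}(V)$, and irreducible otherwise. $G$ is an $\mathbb{R}$-subgroup if it leaves invariant a totally real geodesic 2-plane in $\mathbf{H}^2_{\mathbb{C}}$, and is $\mathbb{R}$-Fuchsian if it is a discrete $\mathbb{R}$-subgroup. For a subgroup $\Gamma$ of $\mathrm{SU}(2,1)$, the trace field $\mathbb{Q}(\Gamma)$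 is the subfield of $\mathbb{C}$ generated over $\mathbb{Q}$ by the traces of all elements of $\Gamma$. The invariant trace field of $G$ is $k(G)=\mathbb{Q}(\Gamma^{3})$, where $\Gamma=\pi^{-1}(G)$ and $\Gamma^{3}=\langle\gamma^3:\gamma\in\Gamma\rangle$ is the subgroup generated by all cubes. *)

theory Defs
  imports "HOL-Analysis.Analysis" "HOL-Algebra.Algebra" "HOL-Algebra.Algebraic_Closure_Type"
begin

section \<open>The Hermitian form and the unitary groups\<close>

definition herm :: "complex^3 \<Rightarrow> complex^3 \<Rightarrow> complex" where
  "herm z w = z$1 * cnj (w$3) + z$2 * cnj (w$2) + z$3 * cnj (w$1)"

lemma herm_self_real: "herm v v \<in> \<real>"
  by (simp add: herm_def complex_is_Real_iff mult.commute)

definition U21 :: "(complex^3^3) monoid" where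
  "U21 = \<lparr>carrier = {A. \<forall>z w. herm (A *v z) (A *v w) = herm z w},
          monoid.mult = (**), one = mat 1\<rparr>"

definition SU21 :: "(complex^3^3) monoid" where
  "SU21 = U21\<lparr>carrier := {A \<in> carrier U21. det A = 1}\<rparr>"

definition U21_scalars :: "(complex^3^3) set" where
  "U21_scalars = {A \<in> carrier U21. \<exists>c. A = mat c}"

definition PU21 :: "(complex^3^3) set monoid" where
  "PU21 = U21 Mod U21_scalars"

definition PU21_class :: "complex^3^3 \<Rightarrow> (complex^3^3) set" where
  "PU21_class A = U21_scalars #>\<^bsub>U21\<^esub> A"

text \<open>The quotient topology; lemma \<open>quotient_map_PU21\<close> below states that it really is one.\<close>

definition PU21_topology :: "(complex^3^3) set topology" where
  "PU21_topology = topology (\<lambda>S. S \<subseteq> carrier PU21 \<and>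
     openin (top_of_set (carrier U21)) {A \<in> carrier U21. PU21_class A \<in> S})"

definition discrete_in_PU21 :: "(complex^3^3) set set \<Rightarrow> bool" where
  "discrete_in_PU21 G \<longleftrightarrow> subtopology PU21_topology G = discrete_topology G"


section \<open>The action on the projective plane\<close>

text \<open>A point of the projective plane is a complex line through the origin, as a set of vectors.\<close>

definition CP2 :: "(complex^3) set set" where
  "CP2 = {vec.span {v} |v. v \<noteq> 0}"

text \<open>The real part only serves to make the order available: \<open>herm v v\<close> is real.\<close>

definition H2C :: "(complex^3) set set" where
  "H2C = {vec.span {v} |v. Re (herm v v) < 0}"

text \<open>All representatives \<open>A\<close> of a class map a line to the same line, so the union below
  is simply the image of \<open>L\<close> under any one of them (lemma \<open>PU21_act_class\<close>).\<close>

definition PU21_act :: "(complex^3^3) set \<Rightarrow> (complex^3) set \<Rightarrow> (complex^3) set" where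
  "PU21_act g L = (\<Union>A\<in>g. (*v) A ` L)"

definition std_real_plane :: "(complex^3) set set" where
  "std_real_plane = {vec.span {v} |v. v \<noteq> 0 \<and> (\<forall>i. v$i \<in> \<real>)} \<inter> H2C"

definition totally_real_plane :: "(complex^3) set set \<Rightarrow> bool" where
  "totally_real_plane P \<longleftrightarrow> (\<exists>g\<in>carrier PU21. P = PU21_act g ` std_real_plane)"


section \<open>Subgroups of PU(2,1)\<close>

definition reducible_PU21 :: "(complex^3^3) set set \<Rightarrow> bool" where
  "reducible_PU21 G \<longleftrightarrow> (\<exists>p\<in>CP2. \<forall>g\<in>G. PU21_act g p = p)"

definition R_subgroup :: "(complex^3^3) set set \<Rightarrow> bool" where
  "R_subgroup G \<longleftrightarrow> subgroup G PU21 \<and>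
     (\<exists>P. totally_real_plane P \<and> (\<forall>g\<in>G. PU21_act g ` P = P))"

definition R_Fuchsian :: "(complex^3^3) set set \<Rightarrow> bool" where
  "R_Fuchsian G \<longleftrightarrow> R_subgroup G \<and> discrete_in_PU21 G"

definition trace_field :: "(complex^3^3) set \<Rightarrow> complex set" where
  "trace_field \<Gamma> = generate_field ring_of_type_algebra (trace ` \<Gamma>)"

definition SU21_lift :: "(complex^3^3) set set \<Rightarrow> (complex^3^3) set" where
  "SU21_lift G = {A \<in> carrier SU21. PU21_class A \<in> G}"

definition cube_subgroup :: "(complex^3^3) set \<Rightarrow> (complex^3^3) set" where
  "cube_subgroup \<Gamma> = generate SU21 ((\<lambda>A. A [^]\<^bsub>SU21\<^esub> (3::nat)) ` \<Gamma>)"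

definition invariant_trace_field :: "(complex^3^3) set set \<Rightarrow> complex set" where
  "invariant_trace_field G = trace_field (cube_subgroup (SU21_lift G))"


section \<open>Well-definedness\<close>

lemma U21_simps [simp]:
  "x \<otimes>\<^bsub>U21\<^esub> y = x ** y" "\<one>\<^bsub>U21\<^esub> = mat 1"
  by (simp_all add: U21_def)

lemma carrier_U21: "A \<in> carrier U21 \<longleftrightarrow> (\<forall>z w. herm (A *v z) (A *v w) = herm z w)"
  by (simp add: U21_def)

lemma SU21_simps [simp]:
  "x \<otimes>\<^bsub>SU21\<^esub> y = x ** y" "\<one>\<^bsub>SU21\<^esub> = mat 1"
  by (simp_all add: SU21_def)

lemma herm_nondegenerate:
  assumes "\<And>z. herm w z = 0"
  shows "w = 0"
proof -
  have "herm w (axis 3 1) = 0" "herm w (axis 2 1) = 0" "herm w (axis 1 1) = 0"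
    using assms by blast+
  then show ?thesis
    by (simp add: herm_def axis_def vec_eq_iff forall_3)
qed

lemma group_U21: "group U21"
proof (rule groupI)
  fix A assume A: "A \<in> carrier U21"
  have "x = 0" if "A *v x = 0" for x
  proof (rule herm_nondegenerate)
    fix z
    have "herm x z = herm (A *v x) (A *v z)"
      using A by (simp add: carrier_U21)
    then show "herm x z = 0" using that by (simp add: herm_def)
  qed
  then have "\<exists>B. B ** A = mat 1"
    by (subst matrix_left_invertible_ker) blast
  then obtain B where BA: "B ** A = mat 1" by blast
  then have AB: "A ** B = mat 1" by (simp add: matrix_left_right_inverse)
  have "herm (B *v z) (B *v w) = herm z w" for z w
  proof -
    have "herm (B *v z) (B *v w) = herm (A *v (B *v z)) (A *v (B *v w))"
      using A by (simp add: carrier_U21)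
    then show ?thesis by (simp add: matrix_vector_mul_assoc AB)
  qed
  then show "\<exists>y\<in>carrier U21. y \<otimes>\<^bsub>U21\<^esub> A = \<one>\<^bsub>U21\<^esub>"
    using BA by (auto simp: carrier_U21)
qed (auto simp: carrier_U21 matrix_mul_assoc simp flip: matrix_vector_mul_assoc)

lemma mat_mult: "mat c ** A = (\<chi> i j. c * A$i$j)" "A ** mat c = (\<chi> i j. c * A$i$j)"
  for A :: "complex^3^3"
  by (auto simp: matrix_matrix_mult_def mat_def vec_eq_iff if_distrib if_distribR mult.commute
      cong: if_cong)

lemma mat_mult_vec: "mat c *v x = c *s x" for x :: "complex^3"
  by (simp add: matrix_vector_mult_def mat_def vec_eq_iff if_distribR if_distrib cong: if_cong)

lemma herm_scale: "herm (c *s z) (c *s w) = c * cnj c * herm z w"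
  by (simp add: herm_def algebra_simps)

lemma mat_in_U21: "mat c \<in> carrier U21 \<longleftrightarrow> cmod c = 1"
proof
  assume "mat c \<in> carrier U21"
  then have "herm (c *s axis 2 1) (c *s axis 2 1) = herm (axis 2 1) (axis 2 1)"
    by (simp add: carrier_U21 mat_mult_vec)
  then have "c * cnj c = 1"
    by (simp add: herm_def axis_def)
  then show "cmod c = 1"
    by (metis complex_mod_mult_cnj norm_one norm_ge_zero power2_eq_1_iff power2_eq_square
        abs_of_nonneg abs_minus_cancel abs_1)
next
  assume "cmod c = 1"
  then have "c * cnj c = 1" by (simp add: complex_norm_square [symmetric])
  then show "mat c \<in> carrier U21"
    by (simp add: carrier_U21 mat_mult_vec herm_scale)
qed

lemma U21_scalars_eq: "U21_scalars = mat ` {c. cmod c = 1}"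
  by (auto simp: U21_scalars_def mat_in_U21)

lemma subgroup_U21_scalars: "subgroup U21_scalars U21"
proof -
  interpret group U21 by (rule group_U21)
  have mm: "mat c ** mat d = (mat (c * d) :: complex^3^3)" for c d
    by (subst mat_mult(1)) (simp add: mat_def vec_eq_iff)
  show ?thesis
  proof (rule subgroupI)
    fix A assume "A \<in> U21_scalars"
    then obtain c where A: "A = mat c" "cmod c = 1" by (auto simp: U21_scalars_eq)
    have "c \<noteq> 0" using A by auto
    then have "mat (inverse c) ** A = mat 1" by (simp add: A mm)
    moreover have "mat (inverse c) \<in> U21_scalars"
      using A by (auto simp: U21_scalars_eq norm_inverse)
    moreover have "A \<in> carrier U21" using A by (simp add: mat_in_U21)
    ultimately show "inv\<^bsub>U21\<^esub> A \<in> U21_scalars"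
      using inv_equality[of "mat (inverse c)" A] by (auto simp: U21_scalars_def)
  next
    show "U21_scalars \<noteq> {}" by (auto simp: U21_scalars_eq intro!: exI[of _ 1])
    show "U21_scalars \<subseteq> carrier U21" by (auto simp: U21_scalars_def)
    show "\<And>a b. a \<in> U21_scalars \<Longrightarrow> b \<in> U21_scalars \<Longrightarrow> a \<otimes>\<^bsub>U21\<^esub> b \<in> U21_scalars"
      by (auto simp: U21_scalars_eq mm norm_mult)
  qed
qed

lemma normal_U21_scalars: "U21_scalars \<lhd> U21"
proof -
  interpret group U21 by (rule group_U21)
  show ?thesis
    by (rule normalI[OF subgroup_U21_scalars])
      (auto simp: r_coset_def l_coset_def U21_scalars_eq mat_mult)
qed

lemma group_PU21: "group PU21"
  unfolding PU21_def by (rule normal.factorgroup_is_group[OF normal_U21_scalars])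

lemma subgroup_SU21: "subgroup (carrier SU21) U21"
proof -
  interpret group U21 by (rule group_U21)
  show ?thesis
  proof (rule subgroupI)
    fix A assume A: "A \<in> carrier SU21"
    then have "A \<in> carrier U21" "det A = 1" by (auto simp: SU21_def)
    then have "inv\<^bsub>U21\<^esub> A ** A = mat 1" using l_inv[of A] by simp
    then have "det (inv\<^bsub>U21\<^esub> A) * det A = 1" by (metis det_mul det_I)
    then show "inv\<^bsub>U21\<^esub> A \<in> carrier SU21"
      using \<open>A \<in> carrier U21\<close> \<open>det A = 1\<close> by (simp add: SU21_def)
  next
    have "mat 1 \<in> carrier SU21" using mat_in_U21[of 1] by (simp add: SU21_def)
    then show "carrier SU21 \<noteq> {}" by blast
    show "carrier SU21 \<subseteq> carrier U21" by (auto simp: SU21_def)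
    show "\<And>a b. a \<in> carrier SU21 \<Longrightarrow> b \<in> carrier SU21 \<Longrightarrow> a \<otimes>\<^bsub>U21\<^esub> b \<in> carrier SU21"
      using m_closed by (auto simp: SU21_def det_mul)
  qed
qed

lemma group_SU21: "group SU21"
  using subgroup.subgroup_is_group[OF subgroup_SU21 group_U21] by (simp add: SU21_def)

lemma carrier_PU21: "carrier PU21 = PU21_class ` carrier U21"
  by (auto simp: PU21_def FactGroup_def RCOSETS_def PU21_class_def)

lemma PU21_class_eq: "PU21_class A = {mat c ** A |c. cmod c = 1}"
  by (auto simp: PU21_class_def r_coset_def U21_scalars_eq)

lemma PU21_class_scale:
  assumes "cmod c = 1"
  shows "PU21_class (mat c ** A) = PU21_class A"
proof -
  have mm: "mat c ** (mat d ** A) = mat (c * d) ** A" for c d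
    by (simp add: mat_mult vec_eq_iff mult.assoc)
  have c0: "c \<noteq> 0" using assms by auto
  have "mat d ** A = mat (d / c) ** (mat c ** A)" for d
    using c0 by (simp add: mm)
  moreover have "cmod (d / c) = 1" if "cmod d = 1" for d
    using that assms by (simp add: norm_divide)
  ultimately have "PU21_class A \<subseteq> PU21_class (mat c ** A)"
    unfolding PU21_class_eq by blast
  moreover have "PU21_class (mat c ** A) \<subseteq> PU21_class A"
    using assms by (auto simp: PU21_class_eq mm) (metis mult_1 norm_mult)
  ultimately show ?thesis by blast
qed

lemma PU21_class_surj: "PU21_class ` carrier SU21 = carrier PU21"
proof
  show "PU21_class ` carrier SU21 \<subseteq> carrier PU21"
    by (auto simp: carrier_PU21 SU21_def)
  show "carrier PU21 \<subseteq> PU21_class ` carrier SU21"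
  proof
    interpret group U21 by (rule group_U21)
    fix g assume "g \<in> carrier PU21"
    then obtain A where A: "A \<in> carrier U21" "g = PU21_class A" by (auto simp: carrier_PU21)
    define J :: "complex^3^3" where "J = (\<chi> i j. if (i,j) \<in> {(1,3),(2,2),(3,1)} then 1 else 0)"
    define C where "C = (\<chi> i j. cnj (A$i$j))"
    have f: "herm (A *v axis i 1) (A *v axis j 1) = (transpose A ** J ** C) $ i $ j" for i j
    proof -
      have "(A *v axis i 1) $ k = A $ k $ i" for i k
        by (simp add: matrix_vector_mult_def axis_def if_distrib cong: if_cong)
      then show ?thesis
        by (simp add: herm_def J_def C_def matrix_matrix_mult_def transpose_def sum_3)
    qed
    have "transpose A ** J ** C = J"
    proof -
      have "(transpose A ** J ** C) $ i $ j = J $ i $ j" for i j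
      proof -
        have "(transpose A ** J ** C) $ i $ j = herm (axis i 1) (axis j 1)"
          using A(1) by (simp add: f[symmetric] carrier_U21)
        also have "\<dots> = J $ i $ j"
          using exhaust_3[of i] exhaust_3[of j]
          by (auto simp: herm_def J_def axis_def)
        finally show ?thesis .
      qed
      then show ?thesis by (simp add: vec_eq_iff)
    qed
    then have "det A * det J * det C = det J" by (metis det_mul det_transpose)
    moreover have "det J = -1" by (simp add: J_def det_3)
    moreover have "det C = cnj (det A)" by (simp add: C_def det_3)
    ultimately have "det A * cnj (det A) = 1" by (simp add: algebra_simps)
    then have "cmod (det A) ^ 2 = 1"
      by (metis complex_norm_square of_real_eq_1_iff)
    then have d1: "cmod (det A) = 1" by (simp add: power2_eq_1_iff) (use norm_ge_zero[of "det A"] in linarith)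
    obtain t where t: "det A = cis t" using complex_unit_circle d1
      by (metis cis_Arg norm_zero sgn_eq scaleR_one div_by_1 zero_neq_one of_real_1)
    define c where "c = cis (- t / 3)"
    have c1: "cmod c = 1" by (simp add: c_def)
    have "c ^ 3 * det A = 1" by (simp add: c_def t Complex.DeMoivre cis_mult)
    moreover have "det (mat c ** A) = c ^ 3 * det A"
      by (simp add: det_3 mat_mult power3_eq_cube algebra_simps)
    ultimately have "mat c ** A \<in> carrier SU21"
      using m_closed[of "mat c" A] A(1) c1 by (simp add: SU21_def mat_in_U21)
    then show "g \<in> PU21_class ` carrier SU21"
      using PU21_class_scale[OF c1] A(2) by (metis imageI)
  qed
qed

lemma openin_PU21_topology:
  "openin PU21_topology S \<longleftrightarrow> S \<subseteq> carrier PU21 \<and>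
     openin (top_of_set (carrier U21)) {A \<in> carrier U21. PU21_class A \<in> S}"
proof -
  have "istopology (\<lambda>S. S \<subseteq> carrier PU21 \<and>
     openin (top_of_set (carrier U21)) {A \<in> carrier U21. PU21_class A \<in> S})"
    unfolding istopology_def
  proof (intro conjI allI impI)
    fix S T assume "S \<subseteq> carrier PU21 \<and>
        openin (top_of_set (carrier U21)) {A \<in> carrier U21. PU21_class A \<in> S}"
      and "T \<subseteq> carrier PU21 \<and>
        openin (top_of_set (carrier U21)) {A \<in> carrier U21. PU21_class A \<in> T}"
    moreover have "{A \<in> carrier U21. PU21_class A \<in> S \<inter> T} =
        {A \<in> carrier U21. PU21_class A \<in> S} \<inter> {A \<in> carrier U21. PU21_class A \<in> T}" by blast
    ultimately show "S \<inter> T \<subseteq> carrier PU21"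
      "openin (top_of_set (carrier U21)) {A \<in> carrier U21. PU21_class A \<in> S \<inter> T}"
      by (auto simp: openin_Int)
  next
    fix \<K> assume K: "\<forall>K\<in>\<K>. K \<subseteq> carrier PU21 \<and>
        openin (top_of_set (carrier U21)) {A \<in> carrier U21. PU21_class A \<in> K}"
    then show "\<Union>\<K> \<subseteq> carrier PU21" by blast
    have "{A \<in> carrier U21. PU21_class A \<in> \<Union>\<K>} =
        (\<Union>K\<in>\<K>. {A \<in> carrier U21. PU21_class A \<in> K})" by blast
    moreover have "openin (top_of_set (carrier U21))
        (\<Union>K\<in>\<K>. {A \<in> carrier U21. PU21_class A \<in> K})"
      by (rule openin_Union) (use K in auto)
    ultimately show "openin (top_of_set (carrier U21)) {A \<in> carrier U21. PU21_class A \<in> \<Union>\<K>}"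
      by metis
  qed
  then show ?thesis
    by (simp add: PU21_topology_def)
qed

lemma topspace_PU21 [simp]: "topspace PU21_topology = carrier PU21"
proof -
  have "{A \<in> carrier U21. PU21_class A \<in> carrier PU21} = carrier U21"
    by (auto simp: carrier_PU21)
  then have "openin PU21_topology (carrier PU21)"
    by (simp add: openin_PU21_topology)
  then have "carrier PU21 \<subseteq> topspace PU21_topology"
    by (rule openin_subset)
  moreover have "topspace PU21_topology \<subseteq> carrier PU21"
    using openin_topspace[of PU21_topology] unfolding openin_PU21_topology by (rule conjunct1)
  ultimately show ?thesis by (rule subset_antisym[rotated])
qed

lemma quotient_map_PU21: "quotient_map (top_of_set (carrier U21)) PU21_topology PU21_class"
  by (auto simp: quotient_map_def openin_PU21_topology carrier_PU21)

lemma PU21_act_class: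
  assumes "L \<in> CP2"
  shows "PU21_act (PU21_class A) L = (*v) A ` L"
proof
  obtain v where L: "L = range (\<lambda>k. k *s v)"
    using assms by (auto simp: CP2_def vec.span_singleton)
  have "mat c *v (A *v (k *s v)) = A *v ((c * k) *s v)" for c k
    by (simp add: mat_mult_vec vec.scale mult.assoc)
  moreover have "A *v (k *s v) \<in> (*v) A ` L" for k
    unfolding L by blast
  ultimately show "PU21_act (PU21_class A) L \<subseteq> (*v) A ` L"
    by (auto simp: PU21_act_def PU21_class_eq L simp flip: matrix_vector_mul_assoc)
  have "A \<in> PU21_class A"
    unfolding PU21_class_eq by (auto intro!: exI[of _ 1])
  then show "(*v) A ` L \<subseteq> PU21_act (PU21_class A) L"
    by (auto simp: PU21_act_def)
qed

end

theory Submission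
  imports Defs
begin

text \<open>Let \<open>\<Gamma>\<close> be the preimage of \<open>G\<close> in SU(2,1) and \<open>N\<close> the subgroup generated by the cubes.
  If \<open>G\<close> preserves a totally real plane, then in suitable coordinates every element of \<open>\<Gamma>\<close> is a
  scalar times a real matrix; determinant 1 makes the cube of the scalar real, so \<open>N\<close> consists
  of real matrices.

  Conversely let the traces on \<open>N\<close> be real. If \<open>N\<close> fixes a point of the projective plane, then it
  is diagonalised by a \<open>\<Gamma>\<close>-orbit, and since nonpositive vectors on different lines are never
  orthogonal, \<open>N\<close> is scalar, hence trivial. Then \<open>\<Gamma>\<close> has exponent 3, conjugate elements
  commute, and an eigenvector of a nonscalar element spoils irreducibility in the same way.
  If \<open>N\<close> fixes no point, the real span of \<open>N\<close> contains a rank-one matrix with image spanned by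
  some \<open>e\<close>, built from an element of \<open>N\<close> and its eigenvalue 1. The real span of the orbit
  \<open>N e\<close> is a real form of the space on which the Hermitian form is real, and \<open>\<Gamma>\<close>, which
  normalises \<open>N\<close>, preserves it up to scalars.\<close>

section \<open>Linear algebra of the Hermitian form\<close>

no_notation fps_nth (infixl \<open>$\<close> 75)

lemma herm_linear:
  "herm (u + v) w = herm u w + herm v w" "herm u (v + w) = herm u v + herm u w"
  "herm (u - v) w = herm u w - herm v w" "herm u (v - w) = herm u v - herm u w"
  "herm (c *s u) w = c * herm u w" "herm u (c *s w) = cnj c * herm u w"
  "herm 0 w = 0" "herm u 0 = 0"
  by (simp_all add: herm_def algebra_simps)

lemma herm_commute: "herm w v = cnj (herm v w)"
  by (simp add: herm_def algebra_simps)

lemma herm_eq_0_commute: "herm w v = 0 \<longleftrightarrow> herm v w = 0"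
  by (metis herm_commute complex_cnj_zero)

lemma herm_self_eq: "herm v v = of_real (Re (herm v v))"
  using herm_self_real by (metis of_real_Re)

lemma complex3_eq_iff: "(v = w) \<longleftrightarrow> v$1 = w$1 \<and> v$2 = w$2 \<and> v$3 = w$3" for v w :: "complex^3"
  by (simp add: vec_eq_iff forall_3)

text \<open>The vector representing the linear form \<open>z \<mapsto> det (z, v, x)\<close> with respect to the Hermitian form.\<close>

definition hcross :: "complex^3 \<Rightarrow> complex^3 \<Rightarrow> complex^3" where
  "hcross v x = vector [cnj (v$1 * x$2 - v$2 * x$1), cnj (v$3 * x$1 - v$1 * x$3),
    cnj (v$2 * x$3 - v$3 * x$2)]"

lemma herm_hcross:
  "herm z (hcross v x) = z$1 * (v$2 * x$3 - v$3 * x$2) + z$2 * (v$3 * x$1 - v$1 * x$3)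
     + z$3 * (v$1 * x$2 - v$2 * x$1)"
  by (simp add: herm_def hcross_def)

lemma herm_hcross_same [simp]: "herm v (hcross v x) = 0" "herm x (hcross v x) = 0"
  by (simp_all add: herm_hcross algebra_simps)

lemma herm_hcross_rotate: "herm v (hcross x z) = herm z (hcross v x)"
  by (simp add: herm_hcross algebra_simps)

lemma hcross_eq_0_imp_dependent:
  assumes "hcross v x = 0" "v \<noteq> 0"
  shows "\<exists>c. x = c *s v"
proof -
  have e: "v$1 * x$2 = v$2 * x$1" "v$3 * x$1 = v$1 * x$3" "v$2 * x$3 = v$3 * x$2"
    using assms(1) by (simp_all add: hcross_def complex3_eq_iff del: complex_cnj_mult complex_cnj_diff)
  obtain i where i: "v$i \<noteq> 0" using assms(2) by (auto simp: vec_eq_iff)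
  have "v$i * x$j = v$j * x$i" for j
    using exhaust_3[of i] exhaust_3[of j] by (elim disjE) (simp_all add: e)
  then have "x = (x$i / v$i) *s v"
    using i by (simp add: vec_eq_iff field_simps)
  then show ?thesis ..
qed

text \<open>The double cross product of \<open>v\<close>, \<open>x\<close> and the reversed
  conjugate of \<open>u\<close> expands into terms with a factor \<open>herm v u\<close> or
  \<open>herm x u\<close>. Hence it vanishes, and \<open>u\<close> is parallel to
  \<open>hcross v x\<close>.\<close>

lemma perp_unique:
  assumes "hcross v x \<noteq> 0" "herm v u = 0" "herm x u = 0"
  shows "\<exists>c. u = c *s hcross v x"
proof -
  define a where "a = cnj (u$3)"
  define b where "b = cnj (u$2)"
  define c where "c = cnj (u$1)"
  have p: "v$1 * a + v$2 * b + v$3 * c = 0" "x$1 * a + x$2 * b + x$3 * c = 0"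
    using assms by (simp_all add: herm_def a_def b_def c_def)
  have "hcross (hcross v x) u = 0"
  proof -
    have "c * (v$3 * x$1 - v$1 * x$3) - b * (v$1 * x$2 - v$2 * x$1)
        = x$1 * (v$1 * a + v$2 * b + v$3 * c) - v$1 * (x$1 * a + x$2 * b + x$3 * c)"
      "a * (v$1 * x$2 - v$2 * x$1) - c * (v$2 * x$3 - v$3 * x$2)
        = x$2 * (v$1 * a + v$2 * b + v$3 * c) - v$2 * (x$1 * a + x$2 * b + x$3 * c)"
      "b * (v$2 * x$3 - v$3 * x$2) - a * (v$3 * x$1 - v$1 * x$3)
        = x$3 * (v$1 * a + v$2 * b + v$3 * c) - v$3 * (x$1 * a + x$2 * b + x$3 * c)"
      by (simp_all add: algebra_simps)
    then have q: "c * (v$3 * x$1 - v$1 * x$3) = b * (v$1 * x$2 - v$2 * x$1)"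
      "a * (v$1 * x$2 - v$2 * x$1) = c * (v$2 * x$3 - v$3 * x$2)"
      "b * (v$2 * x$3 - v$3 * x$2) = a * (v$3 * x$1 - v$1 * x$3)"
      unfolding p by simp_all
    have u: "u$1 = cnj c" "u$2 = cnj b" "u$3 = cnj a" by (simp_all add: a_def b_def c_def)
    show ?thesis
      using q[THEN arg_cong[where f = cnj]]
      unfolding hcross_def[of _ u] complex3_eq_iff u by (simp add: hcross_def ac_simps)
  qed
  then show ?thesis using hcross_eq_0_imp_dependent assms(1) by blast
qed

text \<open>Cramer's rule. Since \<open>herm z (hcross v x)\<close> is the determinant of the rows
  \<open>z\<close>, \<open>v\<close>, \<open>x\<close>, its being nonzero serves throughout as the
  criterion for a basis.\<close>

lemma basis_coordinates:
  assumes "herm z (hcross v x) \<noteq> 0"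
  obtains a b c where "w = a *s z + b *s v + c *s x"
proof
  define D where "D = herm z (hcross v x)"
  have D: "D \<noteq> 0" using assms by (simp add: D_def)
  have "D *s w = herm w (hcross v x) *s z + herm w (hcross x z) *s v + herm w (hcross z v) *s x"
    unfolding D_def complex3_eq_iff herm_hcross by (simp add: algebra_simps)
  then have "(1 / D) *s (D *s w) = (1 / D) *s
      (herm w (hcross v x) *s z + herm w (hcross x z) *s v + herm w (hcross z v) *s x)" by simp
  then show "w = (herm w (hcross v x) / D) *s z + (herm w (hcross x z) / D) *s v
      + (herm w (hcross z v) / D) *s x"
    using D by (simp add: vec.scale_right_distrib)
qed

lemma basis_independent:
  assumes "herm z (hcross v x) \<noteq> 0" "a *s z + b *s v + c *s x = 0"
  shows "a = 0" "b = 0" "c = 0"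
proof -
  have "herm (a *s z + b *s v + c *s x) y = 0" for y by (simp add: assms herm_linear)
  then have "a * herm z y + b * herm v y + c * herm x y = 0" for y
    by (simp add: herm_linear)
  \<comment> \<open>Each cross product is orthogonal to two of the three vectors and so isolates one
    coefficient.\<close>
  from this[of "hcross v x"] this[of "hcross x z"] this[of "hcross z v"]
  show "a = 0" "b = 0" "c = 0"
    using assms(1) herm_hcross_rotate[of v x z] herm_hcross_rotate[of x z v] by simp_all
qed

lemma basis_pairwise:
  assumes "herm z (hcross v x) \<noteq> 0"
  shows "z \<noteq> c *s v" "z \<noteq> c *s x" "v \<noteq> c *s x" "z \<noteq> 0" "v \<noteq> 0" "x \<noteq> 0"
proof -
  have "herm v (hcross x z) \<noteq> 0" "herm x (hcross z v) \<noteq> 0"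
    using assms herm_hcross_rotate[of v x z] herm_hcross_rotate[of x z v] by simp_all
  with assms show "z \<noteq> c *s v" "z \<noteq> c *s x" "v \<noteq> c *s x" "z \<noteq> 0" "v \<noteq> 0" "x \<noteq> 0"
    by (auto simp: herm_linear)
qed

lemma basis_scalar:
  assumes "herm z (hcross v x) \<noteq> 0" "A *v z = c *s z" "A *v v = c *s v" "A *v x = c *s x"
  shows "A = mat c"
proof -
  have "A *v w = mat c *v w" for w
  proof -
    obtain k l m where "w = k *s z + l *s v + m *s x" using basis_coordinates[OF assms(1)] .
    then show ?thesis
      by (simp add: mat_mult_vec matrix_vector_right_distrib vec.scale assms(2-)
          vec.scale_right_distrib mult.commute)
  qed
  then show ?thesis by (simp add: matrix_eq)
qed

text \<open>Diagonalising the form as $|a|^2 + |b|^2 - |d|^2$, one eliminates the negative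
  coordinate $d$ from a combination of the two vectors.\<close>
lemma nonpositive_orthogonal_dependent:
  assumes u: "Re (herm u u) \<le> 0" "u \<noteq> 0" and w: "Re (herm w w) \<le> 0" and uw: "herm u w = 0"
  shows "\<exists>c. w = c *s u"
proof -
  have sq: "2 * Re (herm z z) = cmod (z$1 + z$3)^2 + 2 * cmod (z$2)^2 - cmod (z$1 - z$3)^2" for z
    unfolding herm_def cmod_power2 by (simp add: power2_eq_square algebra_simps)
  define p where "p = u$1 - u$3"
  define q where "q = w$1 - w$3"
  define y where "y = p *s w - q *s u"
  have p: "p \<noteq> 0"
  proof
    assume "p = 0"
    then have "cmod (u$1 + u$3)^2 + 2 * cmod (u$2)^2 \<le> 0"
      using sq[of u] u by (simp add: p_def)
    then have "u$1 + u$3 = 0" "u$2 = 0"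
      using zero_le_power2[of "cmod (u$1 + u$3)"] zero_le_power2[of "cmod (u$2)"]
      by (smt (verit) norm_eq_zero zero_less_power2)+
    with \<open>p = 0\<close> have "u = 0" by (simp add: p_def complex3_eq_iff)
    then show False using u by blast
  qed
  have wu: "herm w u = 0" using uw by (simp add: herm_eq_0_commute)
  have "herm y y = of_real (cmod p ^ 2) * herm w w + of_real (cmod q ^ 2) * herm u u"
    by (simp add: y_def herm_linear uw wu complex_norm_square algebra_simps del: of_real_power)
  then have "Re (herm y y) = cmod p ^ 2 * Re (herm w w) + cmod q ^ 2 * Re (herm u u)" by simp
  then have "Re (herm y y) \<le> 0"
    using u(1) w by (simp add: add_nonpos_nonpos mult_nonneg_nonpos)
  moreover have "y$1 - y$3 = 0" by (simp add: y_def p_def q_def algebra_simps)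
  ultimately have "cmod (y$1 + y$3)^2 + 2 * cmod (y$2)^2 \<le> 0" using sq[of y] by simp
  then have "y$1 + y$3 = 0" "y$2 = 0"
    using zero_le_power2[of "cmod (y$1 + y$3)"] zero_le_power2[of "cmod (y$2)"]
    by (smt (verit) norm_eq_zero zero_less_power2)+
  with \<open>y$1 - y$3 = 0\<close> have "y = 0" by (simp add: complex3_eq_iff)
  then have "p *s w = q *s u" by (simp add: y_def)
  then have "(1/p) *s (p *s w) = (1/p) *s (q *s u)" by simp
  then show ?thesis using p by auto
qed

text \<open>A nonpositive \<open>y\<close> would be a multiple of \<open>x\<close>, and
  \<open>x\<close> is not orthogonal to itself.\<close>

lemma positive_of_perp_negative:
  assumes "Re (herm x x) < 0" "herm y x = 0" "y \<noteq> 0"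
  shows "Re (herm y y) > 0"
proof (rule ccontr)
  assume "\<not> ?thesis"
  moreover have "x \<noteq> 0" using assms(1) by (auto simp: herm_linear)
  ultimately obtain c where c: "y = c *s x"
    using nonpositive_orthogonal_dependent[of x y] assms by (auto simp: herm_eq_0_commute)
  then have "c * herm x x = 0" using assms(2) by (simp add: herm_linear)
  then show False using assms c by auto
qed

lemma exists_negative: "Re (herm (vector [1, 0, -1]) (vector [1, 0, -1])) < 0"
  by (simp add: herm_def)

section \<open>Irreducible groups\<close>

text \<open>For subgroups of SU(2,1) this is a common fixed point in the projective plane, given by
  a representative vector.\<close>

definition common_eigenvector :: "(complex^3^3) set \<Rightarrow> complex^3 \<Rightarrow> bool" where
  "common_eigenvector S v \<longleftrightarrow> v \<noteq> 0 \<and> (\<forall>A\<in>S. \<exists>c. A *v v = c *s v)"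

lemma subgroup_SU21_facts:
  assumes "subgroup H SU21"
  shows "mat 1 \<in> H" "A \<in> H \<Longrightarrow> B \<in> H \<Longrightarrow> A ** B \<in> H"
    "A \<in> H \<Longrightarrow> herm (A *v z) (A *v w) = herm z w" "A \<in> H \<Longrightarrow> det A = 1"
  using subgroup.m_closed[OF assms, of A B] subgroup.one_closed[OF assms]
    subgroup.mem_carrier[OF assms, of A]
  by (auto simp: SU21_def carrier_U21)

lemma subgroup_SU21_inverse:
  assumes "subgroup H SU21" "A \<in> H"
  obtains B where "B \<in> H" "A ** B = mat 1" "B ** A = mat 1"
proof -
  interpret group SU21 by (rule group_SU21)
  have "A \<in> carrier SU21" by (rule subgroup.mem_carrier[OF assms])
  then show thesis
    using that[of "inv\<^bsub>SU21\<^esub> A"] subgroup.m_inv_closed[OF assms] l_inv[of A] r_inv[of A] by simp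
qed

text \<open>If \<open>u\<close> were orthogonal to the whole orbit of \<open>v\<close>, so would be
  every translate of \<open>u\<close>. The orbit contains two independent vectors, so its orthogonal
  complement is at most a line; \<open>u\<close> would span this line and be a common
  eigenvector.\<close>

lemma orbit_not_perp:
  assumes H: "subgroup H SU21" and irr: "\<And>v. \<not> common_eigenvector H v" and v: "v \<noteq> 0" "u \<noteq> 0"
  shows "\<exists>A\<in>H. herm (A *v v) u \<noteq> 0"
proof (rule ccontr)
  assume "\<not> ?thesis"
  then have z: "herm (A *v v) u = 0" if "A \<in> H" for A using that by blast
  obtain T where T: "T \<in> H" "\<And>c. T *v v \<noteq> c *s v"
    using irr[of v] v(1) unfolding common_eigenvector_def by blast
  have n: "hcross v (T *v v) \<noteq> 0"
    using hcross_eq_0_imp_dependent[OF _ v(1)] T(2) by blast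
  have perp: "herm (A *v v) (Y *v u) = 0" if A: "A \<in> H" and Y: "Y \<in> H" for A Y
  proof -
    obtain Z where Z: "Z \<in> H" "Y ** Z = mat 1" using subgroup_SU21_inverse[OF H Y] .
    have "herm (A *v v) (Y *v u) = herm (Y *v ((Z ** A) *v v)) (Y *v u)"
      by (simp add: matrix_vector_mul_assoc matrix_mul_assoc Z)
    also have "\<dots> = herm ((Z ** A) *v v) u"
      by (rule subgroup_SU21_facts(3)[OF H Y])
    also have "\<dots> = 0" by (rule z) (rule subgroup_SU21_facts(2)[OF H Z(1) A])
    finally show ?thesis .
  qed
  have "\<exists>c. Y *v u = c *s hcross v (T *v v)" if "Y \<in> H" for Y
    using perp_unique[OF n] perp[OF subgroup_SU21_facts(1)[OF H] that] perp[OF T(1) that] by simp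
  then obtain c where c: "\<And>Y. Y \<in> H \<Longrightarrow> Y *v u = c Y *s hcross v (T *v v)" by metis
  have u: "u = c (mat 1) *s hcross v (T *v v)"
    using c[OF subgroup_SU21_facts(1)[OF H]] by simp
  with v have "c (mat 1) \<noteq> 0" by auto
  then have "Y *v u = (c Y / c (mat 1)) *s u" if "Y \<in> H" for Y
    by (subst (2) u) (simp add: c[OF that])
  then have "common_eigenvector H u" using v by (auto simp: common_eigenvector_def)
  then show False using irr by blast
qed

text \<open>Take a translate of \<open>v\<close> off the line of \<open>v\<close>, then a translate
  not orthogonal to the cross product of these two.\<close>

lemma orbit_basis:
  assumes H: "subgroup H SU21" and irr: "\<And>v. \<not> common_eigenvector H v" and v: "v \<noteq> 0"
  obtains A B where "A \<in> H" "B \<in> H" "herm (A *v v) (hcross v (B *v v)) \<noteq> 0"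
proof -
  obtain B where B: "B \<in> H" "\<And>c. B *v v \<noteq> c *s v"
    using irr[of v] v unfolding common_eigenvector_def by blast
  then have "hcross v (B *v v) \<noteq> 0"
    using hcross_eq_0_imp_dependent[OF _ v] by blast
  then show thesis using orbit_not_perp[OF H irr v] B(1) that by blast
qed

lemma subgroup_SU21_vec_nonzero:
  assumes "subgroup H SU21" "A \<in> H" "v \<noteq> 0"
  shows "A *v v \<noteq> 0"
proof
  assume 0: "A *v v = 0"
  obtain B where "B ** A = mat 1" using subgroup_SU21_inverse[OF assms(1,2)] by metis
  then have "v = B *v (A *v v)" by (simp add: matrix_vector_mul_assoc)
  then show False using 0 assms(3) by simp
qed

text \<open>Clifford theory: \<open>\<Gamma>\<close> permutes the common eigenlines of
  \<open>S\<close>, and by irreducibility three of them form a basis. Eigenvectors that are not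
  orthogonal have linked eigenvalues, and the signature (2,1) allows too little orthogonality for
  the eigenvalues to differ. \<open>S\<close> need not be a group, since the lemma is also applied
  to a conjugacy class.\<close>

lemma clifford_scalar:
  assumes G: "subgroup \<Gamma> SU21" and irr: "\<And>v. \<not> common_eigenvector \<Gamma> v"
    and S: "\<And>A z w. A \<in> S \<Longrightarrow> herm (A *v z) (A *v w) = herm z w"
    and norm: "\<And>A C. A \<in> S \<Longrightarrow> C \<in> \<Gamma> \<Longrightarrow> \<exists>B\<in>S. A ** C = C ** B"
    and ev: "common_eigenvector S v" and A: "A \<in> S"
  shows "\<exists>c. A = mat c"
proof -
  have image: "common_eigenvector S (C *v w)" if w: "common_eigenvector S w" and C: "C \<in> \<Gamma>" for w C
    unfolding common_eigenvector_def
  proof (intro conjI ballI)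
    show "C *v w \<noteq> 0"
      using subgroup_SU21_vec_nonzero[OF G C] w by (simp add: common_eigenvector_def)
    fix A assume "A \<in> S"
    then obtain B where B: "B \<in> S" "A ** C = C ** B" using norm C by blast
    then obtain c where "B *v w = c *s w" using w by (auto simp: common_eigenvector_def)
    then have "A *v (C *v w) = c *s (C *v w)"
      by (simp add: matrix_vector_mul_assoc B) (simp add: vec.scale flip: matrix_vector_mul_assoc)
    then show "\<exists>c. A *v (C *v w) = c *s (C *v w)" ..
  qed
  have orbit: thesis
    if w: "common_eigenvector S w"
      and *: "\<And>x1 x2 x3. common_eigenvector S x1 \<Longrightarrow> common_eigenvector S x2 \<Longrightarrow>
        common_eigenvector S x3 \<Longrightarrow> herm x1 x1 = herm w w \<Longrightarrow> herm x2 x2 = herm w w \<Longrightarrow>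
        herm x3 x3 = herm w w \<Longrightarrow> herm x1 (hcross x2 x3) \<noteq> 0 \<Longrightarrow> thesis" for w thesis
  proof -
    have "w \<noteq> 0" using w by (simp add: common_eigenvector_def)
    then obtain P Q where PQ: "P \<in> \<Gamma>" "Q \<in> \<Gamma>" "herm (P *v w) (hcross w (Q *v w)) \<noteq> 0"
      using orbit_basis[OF G irr] by metis
    show ?thesis
      by (rule *[OF image[OF w PQ(1)] w image[OF w PQ(2)] _ _ _ PQ(3)])
        (simp_all add: subgroup_SU21_facts(3)[OF G] PQ)
  qed
  have unit: "c * cnj d = 1"
    if "B \<in> S" "B *v x = c *s x" "B *v y = d *s y" "herm x y \<noteq> 0" for B c d x y
    using S[OF that(1), of x y] that by (simp add: herm_linear ac_simps)
  \<comment> \<open>Nonpositive vectors on different lines are never orthogonal, so all three pairs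
    are linked. Isotropic eigenvectors may have eigenvalues off the unit circle, so equality needs
    the comparison of all three pairs.\<close>
  have nonpos: "\<exists>c. A = mat c"
    if w: "common_eigenvector S w" "Re (herm w w) \<le> 0" for w
  proof (rule orbit[OF w(1)])
    fix x1 x2 x3
    assume e: "common_eigenvector S x1" "common_eigenvector S x2" "common_eigenvector S x3"
      and n: "herm x1 x1 = herm w w" "herm x2 x2 = herm w w" "herm x3 x3 = herm w w"
      and b: "herm x1 (hcross x2 x3) \<noteq> 0"
    obtain c1 c2 c3 where c: "A *v x1 = c1 *s x1" "A *v x2 = c2 *s x2" "A *v x3 = c3 *s x3"
      using e A unfolding common_eigenvector_def by blast
    have "herm x2 x1 \<noteq> 0" "herm x3 x1 \<noteq> 0" "herm x3 x2 \<noteq> 0"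
      using basis_pairwise[OF b] nonpositive_orthogonal_dependent w(2) n by metis+
    then have "c2 * cnj c1 = 1" "c3 * cnj c1 = 1" "c3 * cnj c2 = 1"
      using unit[OF A] c by blast+
    then have "c2 = c3" "c1 = c2"
      by (metis mult_cancel_right mult_zero_right zero_neq_one)
        (metis \<open>c3 * cnj c1 = 1\<close> \<open>c3 * cnj c2 = 1\<close> complex_cnj_cancel_iff mult_cancel_left
          mult_zero_left zero_neq_one)
    then show ?thesis using basis_scalar[OF b] c by blast
  qed
  have pos: "\<exists>c. A = mat c"
    if e: "common_eigenvector S y1" "common_eigenvector S y2" "common_eigenvector S y3"
      and n: "Re (herm y1 y1) > 0" "Re (herm y2 y2) > 0" "Re (herm y3 y3) > 0"
      and b: "herm y1 (hcross y2 y3) \<noteq> 0" and y12: "herm y1 y2 \<noteq> 0" for y1 y2 y3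
  proof -
    \<comment> \<open>The eigenvalue of a positive vector lies on the unit circle, so here linked
      eigenvalues are equal.\<close>
    have same: "c = d"
      if "B \<in> S" "B *v x = c *s x" "B *v y = d *s y" "herm x y \<noteq> 0" "Re (herm y y) > 0" for B c d x y
    proof -
      have "herm y y \<noteq> 0" using that(5) by auto
      then have "c * cnj d = 1" "d * cnj d = 1" using unit that by blast+
      then show ?thesis by (metis mult_cancel_right mult_zero_right zero_neq_one)
    qed
    show ?thesis
    proof (cases "herm y1 y3 = 0 \<and> herm y2 y3 = 0")
      case False
      obtain c1 c2 c3 where c: "A *v y1 = c1 *s y1" "A *v y2 = c2 *s y2" "A *v y3 = c3 *s y3"
        using e A unfolding common_eigenvector_def by blast
      have "c1 = c2" using same[OF A c(1,2) y12 n(2)] .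
      moreover have "c1 = c3 \<or> c2 = c3"
        using False same[OF A c(1,3) _ n(3)] same[OF A c(2,3) _ n(3)] by blast
      ultimately show ?thesis using basis_scalar[OF b] c by metis
    next
      case True
      \<comment> \<open>Now \<open>y3\<close> is orthogonal to the other two. Dropping the
        \<open>y3\<close> part of a negative vector removes a nonnegative term, so a negative
        \<open>u\<close> remains in the span of \<open>y1\<close> and \<open>y2\<close>. These share
        their eigenvalue, which makes \<open>u\<close> a common eigenvector and leads back to the
        nonpositive case.\<close>
      define z :: "complex^3" where "z = vector [1, 0, -1]"
      obtain k l m where z: "z = k *s y1 + l *s y2 + m *s y3" using basis_coordinates[OF b] .
      define u where "u = k *s y1 + l *s y2"
      have uy: "herm u y3 = 0" using True by (simp add: u_def herm_linear)
      then have yu: "herm y3 u = 0" by (simp add: herm_eq_0_commute[of u])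
      have "herm z z = herm u u + of_real (cmod m ^ 2) * herm y3 y3"
        unfolding z u_def[symmetric]
        by (simp add: herm_linear uy yu complex_norm_square algebra_simps del: of_real_power)
      then have "Re (herm z z) = Re (herm u u) + cmod m ^ 2 * Re (herm y3 y3)" by simp
      moreover have "Re (herm z z) < 0" using exists_negative by (simp add: z_def)
      moreover have "cmod m ^ 2 * Re (herm y3 y3) \<ge> 0" using n(3) by simp
      ultimately have neg: "Re (herm u u) < 0" by linarith
      have "\<exists>c. B *v u = c *s u" if B: "B \<in> S" for B
      proof -
        obtain c1 c2 where c: "B *v y1 = c1 *s y1" "B *v y2 = c2 *s y2"
          using e B unfolding common_eigenvector_def by blast
        have "c1 = c2" using same[OF B c y12 n(2)] .
        then have "B *v u = c1 *s u"
          by (simp add: u_def matrix_vector_right_distrib vec.scale c vec.scale_right_distrib mult.commute)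
        then show ?thesis ..
      qed
      moreover have "u \<noteq> 0" using neg by (auto simp: herm_linear)
      ultimately have "common_eigenvector S u" by (auto simp: common_eigenvector_def)
      then show ?thesis using nonpos neg by force
    qed
  qed
  show ?thesis
  proof (cases "Re (herm v v) \<le> 0")
    case True
    then show ?thesis using nonpos ev by blast
  next
    case False
    show ?thesis
    proof (rule orbit[OF ev])
      fix x1 x2 x3
      assume e: "common_eigenvector S x1" "common_eigenvector S x2" "common_eigenvector S x3"
        and n: "herm x1 x1 = herm v v" "herm x2 x2 = herm v v" "herm x3 x3 = herm v v"
        and b: "herm x1 (hcross x2 x3) \<noteq> 0"
      have p: "Re (herm x1 x1) > 0" "Re (herm x2 x2) > 0" "Re (herm x3 x3) > 0"
        using False n by auto
      have b': "herm x2 (hcross x3 x1) \<noteq> 0" "herm x3 (hcross x1 x2) \<noteq> 0"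
        using b herm_hcross_rotate[of x2 x3 x1] herm_hcross_rotate[of x3 x1 x2] by simp_all
      \<comment> \<open>Three pairwise orthogonal positive vectors would make the form positive
        definite.\<close>
      have "herm x1 x2 \<noteq> 0 \<or> herm x2 x3 \<noteq> 0 \<or> herm x3 x1 \<noteq> 0"
      proof (rule ccontr)
        assume "\<not> ?thesis"
        then have o: "herm x1 x2 = 0" "herm x2 x1 = 0" "herm x2 x3 = 0" "herm x3 x2 = 0"
          "herm x3 x1 = 0" "herm x1 x3 = 0"
          using herm_eq_0_commute by blast+
        define z :: "complex^3" where "z = vector [1, 0, -1]"
        obtain k l m where z: "z = k *s x1 + l *s x2 + m *s x3" using basis_coordinates[OF b] .
        have "herm z z = of_real (cmod k ^ 2 + cmod l ^ 2 + cmod m ^ 2) * herm v v"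
          unfolding z
          by (simp add: herm_linear o n complex_norm_square algebra_simps del: of_real_power)
        then have "Re (herm z z) = (cmod k ^ 2 + cmod l ^ 2 + cmod m ^ 2) * Re (herm v v)" by simp
        moreover have "\<dots> \<ge> 0" using False by simp
        moreover have "Re (herm z z) < 0" using exists_negative by (simp add: z_def)
        ultimately show False by linarith
      qed
      then show ?thesis
        using pos[OF e p b] pos[OF e(2,3,1) p(2,3,1) b'(1)] pos[OF e(3,1,2) p(3,1,2) b'(2)] by blast
    qed
  qed
qed

text \<open>Both sides are determinants of matrices with the given vectors as rows, and determinants
  are multiplicative.\<close>

lemma det_herm_hcross:
  "herm (A *v z) (hcross (A *v v) (A *v x)) = det A * herm z (hcross v x)"
proof -
  define M :: "complex^3 \<Rightarrow> complex^3 \<Rightarrow> complex^3 \<Rightarrow> complex^3^3"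
    where "M z v x = (\<chi> i j. (if i = 1 then z else if i = 2 then v else x) $ j)" for z v x
  have M: "det (M z v x) = herm z (hcross v x)" for z v x
    by (simp add: M_def det_3 herm_hcross algebra_simps)
  have "M z v x ** transpose A = M (A *v z) (A *v v) (A *v x)"
    by (simp add: M_def matrix_matrix_mult_def transpose_def matrix_vector_mult_def vec_eq_iff mult.commute)
  then have "det (M z v x) * det A = det (M (A *v z) (A *v v) (A *v x))"
    by (metis det_mul det_transpose)
  then show ?thesis by (simp add: M mult.commute)
qed

section \<open>Groups of exponent 3\<close>

text \<open>Here \<open>C ** C\<close> is the inverse of \<open>C\<close>. With the conjugates P of
  \<open>A\<close> by \<open>C\<close> and Q of \<open>A\<close> by its inverse, the last two
  hypotheses read APQ = 1 and AQP = 1. Cyclic shifts give QAP = 1 = QPA, whence AP = PA.\<close>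

lemma exponent_3_commutes_conjugate:
  fixes A C :: "'a::field^'n^'n"
  assumes "C ** C ** C = mat 1" "(A ** C) ** (A ** C) ** (A ** C) = mat 1"
    "(A ** (C ** C)) ** (A ** (C ** C)) ** (A ** (C ** C)) = mat 1"
  shows "A ** (C ** A ** (C ** C)) = (C ** A ** (C ** C)) ** A"
proof -
  have C4: "C ** (C ** (C ** M)) = M" for M :: "'a^'n^'n"
    using assms(1) by (simp add: matrix_mul_assoc)
  define P where "P = C ** A ** (C ** C)"
  define Q where "Q = C ** C ** A ** C"
  have 1: "(A ** P) ** Q = mat 1"
    using assms(2) by (simp add: P_def Q_def C4 flip: matrix_mul_assoc)
  then have 2: "Q ** (A ** P) = mat 1" by (simp add: matrix_left_right_inverse)
  have "A ** (Q ** P) = mat 1"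
    using assms(3) by (simp add: P_def Q_def C4 flip: matrix_mul_assoc)
  then have "Q ** P ** A = mat 1" by (simp add: matrix_left_right_inverse)
  then have 3: "Q ** (P ** A) = mat 1" by (simp add: matrix_mul_assoc)
  have "A ** P = (A ** P) ** (Q ** (P ** A))" by (simp add: 3)
  also have "\<dots> = P ** A" by (subst matrix_mul_assoc) (simp add: 1)
  finally show ?thesis unfolding P_def .
qed

lemma exists_primitive_cube_root: "\<exists>\<omega>::complex. 1 + \<omega> + \<omega>^2 = 0"
  by (rule exI[of _ "Complex (-1/2) (sqrt 3 / 2)"]) (simp add: complex_eq_iff power2_eq_square)

text \<open>A discrete Fourier transform: for each cube root of unity \<open>a\<close>, the vector
  \<open>f a\<close> is zero or an eigenvector with eigenvalue \<open>a^2\<close>, the inverse of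
  \<open>a\<close>. The three vectors add up to \<open>3 *s x\<close>, so not all of them
  vanish.\<close>

lemma order_3_eigenvector:
  assumes "A ** A ** A = mat 1"
  obtains e :: "complex" and v :: "complex^3" where "v \<noteq> 0" "A *v v = e *s v" "e ^ 3 = 1"
proof -
  obtain \<omega> :: complex where w: "1 + \<omega> + \<omega>^2 = 0" using exists_primitive_cube_root by blast
  have w3: "\<omega>^3 = 1"
  proof -
    have "\<omega>^3 - 1 = (\<omega> - 1) * (1 + \<omega> + \<omega>^2)"
      by (simp add: power2_eq_square power3_eq_cube algebra_simps)
    then show ?thesis using w by simp
  qed
  define x :: "complex^3" where "x = axis 1 1"
  define f where "f a = x + a *s (A *v x) + a^2 *s (A *v (A *v x))" for a
  have A3: "A *v (A *v (A *v x)) = x"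
    using assms by (simp add: matrix_vector_mul_assoc matrix_mul_assoc)
  have ev: "A *v f a = a^2 *s f a" if "a^3 = 1" for a
  proof -
    have a: "a^2 * a = 1" "a^2 * a^2 = a"
      using that by (simp_all add: power2_eq_square power3_eq_cube ac_simps)
    have "a^4 = a" using that by (simp add: power4_eq_xxxx power3_eq_cube)
    then show ?thesis
      by (simp add: f_def matrix_vector_right_distrib vec.scale A3 vec.scale_right_distrib a)
  qed
  have "f 1 + f \<omega> + f (\<omega>^2) = 3 *s x + (1 + \<omega> + \<omega>^2) *s (A *v x)
      + (1 + \<omega>^2 + (\<omega>^2)^2) *s (A *v (A *v x))"
    by (simp add: f_def complex3_eq_iff algebra_simps)
  also have "(\<omega>^2)^2 = \<omega>" using w3 by (simp add: power2_eq_square power3_eq_cube ac_simps)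
  also have "1 + \<omega>^2 + \<omega> = 0" using w by (simp add: ac_simps)
  finally have "f 1 + f \<omega> + f (\<omega>^2) = 3 *s x" using w by simp
  moreover have "3 *s x \<noteq> 0" by (simp add: x_def)
  ultimately have "f 1 \<noteq> 0 \<or> f \<omega> \<noteq> 0 \<or> f (\<omega>^2) \<noteq> 0" by auto
  moreover have "(\<omega>^2)^3 = 1" using w3 by (metis power_mult mult.commute power_one)
  ultimately obtain a where a: "a^3 = 1" "f a \<noteq> 0" using w3 by (metis power_one)
  moreover have "(a^2)^3 = 1" using a(1) by (metis power_mult mult.commute power_one)
  ultimately show thesis using that ev by blast
qed

text \<open>With two independent eigenvectors for \<open>e\<close>, determinant 1 forces the third
  eigenvalue to be \<open>e\<close> as well. A remaining nilpotent part \<open>u\<close> would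
  appear in the cube of \<open>A\<close> as \<open>(3 * e^2) *s u\<close>, so it is zero. Thus the
  eigenspaces of a nonscalar \<open>A\<close> for cube roots of unity are at most lines.\<close>

lemma order_3_eigenspace:
  fixes A :: "complex^3^3"
  assumes A3: "A ** A ** A = mat 1" and det: "det A = 1" and e: "e ^ 3 = (1::complex)"
    and v: "v \<noteq> 0" "A *v v = e *s v" and x: "A *v x = e *s x" "\<And>c. x \<noteq> c *s v"
  shows "A = mat e"
proof -
  have n: "hcross v x \<noteq> 0" using hcross_eq_0_imp_dependent[OF _ v(1)] x(2) by blast
  then obtain y where b: "herm y (hcross v x) \<noteq> 0"
    using herm_nondegenerate[of "hcross v x"] herm_eq_0_commute by metis
  obtain k l m where y: "A *v y = k *s y + l *s v + m *s x" using basis_coordinates[OF b] .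
  have "herm (A *v y) (hcross (A *v v) (A *v x)) = herm y (hcross v x)"
    by (simp add: det_herm_hcross det)
  moreover have "hcross (A *v v) (A *v x) = (cnj e)^2 *s hcross v x"
    by (simp add: v x hcross_def complex3_eq_iff power2_eq_square algebra_simps)
  ultimately have "e^2 * k * herm y (hcross v x) = herm y (hcross v x)"
    by (simp add: herm_linear y)
  then have "e^2 * k = 1" using b by simp
  then have "e^2 * k = e^2 * e" using e by (simp add: power2_eq_square power3_eq_cube)
  moreover have e0: "e \<noteq> 0" using e by auto
  ultimately have k: "k = e" by simp
  define u where "u = l *s v + m *s x"
  have Au: "A *v u = e *s u"
    by (simp add: u_def matrix_vector_right_distrib vec.scale v x vec.scale_right_distrib mult.commute)
  have Ay: "A *v y = e *s y + u" by (simp add: y k u_def add.assoc)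
  have "y = A *v (A *v (A *v y))" using A3 by (simp add: matrix_vector_mul_assoc matrix_mul_assoc)
  also have "A *v (A *v y) = e^2 *s y + (2 * e) *s u"
    by (simp add: Ay matrix_vector_right_distrib vec.scale Au)
      (simp add: complex3_eq_iff power2_eq_square algebra_simps)
  also have "A *v \<dots> = e^3 *s y + (3 * e^2) *s u"
    by (simp add: Ay matrix_vector_right_distrib vec.scale Au)
      (simp add: complex3_eq_iff power2_eq_square power3_eq_cube algebra_simps)
  finally have "(3 * e^2) *s u = 0" using e by simp
  then have "u = 0" using e0 by simp
  then show ?thesis using basis_scalar[OF b, of A e] Ay v x by simp
qed

text \<open>All conjugates of a nonscalar \<open>A\<close> commute with it and so preserve its
  eigenlines. Clifford theory for the conjugacy class then makes \<open>A\<close> scalar after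
  all.\<close>

lemma exponent_3_reducible:
  assumes G: "subgroup \<Gamma> SU21" and exp3: "\<And>A. A \<in> \<Gamma> \<Longrightarrow> A ** A ** A = mat 1"
  shows "\<exists>v. common_eigenvector \<Gamma> v"
proof (rule ccontr)
  assume "\<nexists>v. common_eigenvector \<Gamma> v"
  then have irr: "\<not> common_eigenvector \<Gamma> v" for v by blast
  have "\<exists>c. A = mat c" if A: "A \<in> \<Gamma>" for A
  proof (rule ccontr)
    assume ns: "\<nexists>c. A = mat c"
    obtain v e where v: "v \<noteq> 0" "A *v v = e *s v" "e ^ 3 = 1"
      using order_3_eigenvector[OF exp3[OF A]] .
    \<comment> \<open>The conjugacy class of \<open>A\<close>, as \<open>C ** C\<close> is the
      inverse of \<open>C\<close>.\<close>
    define S where "S = (\<lambda>C. C ** A ** (C ** C)) ` \<Gamma>"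
    have SG: "S \<subseteq> \<Gamma>" using A by (auto simp: S_def intro!: subgroup_SU21_facts[OF G])
    have "common_eigenvector S v"
      unfolding common_eigenvector_def
    proof (intro conjI ballI v(1))
      fix B assume "B \<in> S"
      then obtain C where C: "C \<in> \<Gamma>" "B = C ** A ** (C ** C)" by (auto simp: S_def)
      have "A ** B = B ** A"
        unfolding C(2) by (rule exponent_3_commutes_conjugate; intro exp3 subgroup_SU21_facts[OF G] A C)
      then have "A *v (B *v v) = B *v (A *v v)" by (simp add: matrix_vector_mul_assoc)
      then have "A *v (B *v v) = e *s (B *v v)" by (simp add: v vec.scale)
      then show "\<exists>c. B *v v = c *s v"
        using order_3_eigenspace[OF exp3[OF A] subgroup_SU21_facts(4)[OF G A] v(3,1,2)] ns by metis
    qed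
    moreover have "A = mat 1 ** A ** (mat 1 ** mat 1)" by simp
    then have "A \<in> S" unfolding S_def using subgroup_SU21_facts(1)[OF G] by blast
    moreover have "\<exists>B'\<in>S. B ** C = C ** B'" if B: "B \<in> S" and C: "C \<in> \<Gamma>" for B C
    proof -
      obtain D where D: "D \<in> \<Gamma>" "B = D ** A ** (D ** D)" using B by (auto simp: S_def)
      \<comment> \<open>\<open>F\<close> is the inverse of \<open>C\<close> times \<open>D\<close>,
        so conjugating \<open>A\<close> by \<open>F\<close> amounts to conjugating \<open>B\<close>
        by the inverse of \<open>C\<close>.\<close>
      define F where "F = C ** C ** D"
      have F: "F \<in> \<Gamma>" using C D by (auto simp: F_def intro!: subgroup_SU21_facts[OF G])
      have CF: "C ** F = D" using exp3[OF C] by (simp add: F_def matrix_mul_assoc)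
      have "D ** (F ** F) = C ** (F ** F ** F)" by (simp add: CF matrix_mul_assoc)
      also have "\<dots> = C" using exp3[OF F] by simp
      finally have "D ** D ** (D ** (F ** F)) = D ** D ** C" by simp
      then have "F ** F = D ** D ** C" using exp3[OF D(1)] by (simp add: matrix_mul_assoc)
      then have "B ** C = C ** (F ** A ** (F ** F))"
        by (simp add: D CF matrix_mul_assoc)
      then show ?thesis using F by (auto simp: S_def)
    qed
    ultimately show False
      using clifford_scalar[OF G irr, of S v A] subgroup_SU21_facts(3)[OF G] SG ns by blast
  qed
  then have "common_eigenvector \<Gamma> (axis 1 1)"
    by (auto simp: common_eigenvector_def) (metis mat_mult_vec)
  then show False using irr by blast
qed

section \<open>Rank-one matrices in the real span of a group with real traces\<close>

text \<open>The adjugate, that is, the transposed cofactor matrix.\<close>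

definition adj3 :: "complex^3^3 \<Rightarrow> complex^3^3" where
  "adj3 Y = vector
    [vector [Y$2$2 * Y$3$3 - Y$2$3 * Y$3$2, Y$1$3 * Y$3$2 - Y$1$2 * Y$3$3, Y$1$2 * Y$2$3 - Y$1$3 * Y$2$2],
     vector [Y$2$3 * Y$3$1 - Y$2$1 * Y$3$3, Y$1$1 * Y$3$3 - Y$1$3 * Y$3$1, Y$1$3 * Y$2$1 - Y$1$1 * Y$2$3],
     vector [Y$2$1 * Y$3$2 - Y$2$2 * Y$3$1, Y$1$2 * Y$3$1 - Y$1$1 * Y$3$2, Y$1$1 * Y$2$2 - Y$1$2 * Y$2$1]]"

lemma mult_adj3: "Y ** adj3 Y = mat (det Y)"
  by (simp add: vec_eq_iff forall_3 matrix_matrix_mult_def sum_3 adj3_def mat_def det_3 algebra_simps)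

text \<open>The Cayley-Hamilton form of the adjugate. It shows that the adjugate stays in a real
  span containing \<open>mat 1\<close>, \<open>Y\<close> and \<open>Y ** Y\<close> when the traces
  are real.\<close>

lemma adj3_eq:
  "(2 * adj3 Y $ i $ j) = 2 * (Y ** Y) $ i $ j - 2 * trace Y * Y $ i $ j
      + (trace Y ^ 2 - trace (Y ** Y)) * mat 1 $ i $ j"
  using exhaust_3[of i] exhaust_3[of j]
  by (elim disjE) (simp_all add: matrix_matrix_mult_def sum_3 adj3_def mat_def trace_def
      power2_eq_square algebra_simps)

lemma rank_one_of_minors:
  fixes E :: "'a::field^'n^'m"
  assumes "E \<noteq> 0" "\<And>i j k l. E$i$j * E$k$l = E$i$l * E$k$j"
  obtains e f where "e \<noteq> 0" "f \<noteq> 0" "E = (\<chi> i j. e$i * f$j)"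
proof -
  obtain p q where pq: "E$p$q \<noteq> 0" using assms(1) by (auto simp: vec_eq_iff)
  define e where "e = (\<chi> i. E$i$q)"
  define f where "f = (\<chi> j. E$p$j / E$p$q)"
  have "E$i$j = e$i * f$j" for i j
    using pq assms(2)[of i j p q] by (simp add: e_def f_def field_simps)
  then have "E = (\<chi> i j. e$i * f$j)" by (simp add: vec_eq_iff)
  moreover have "e$p \<noteq> 0" "f$q \<noteq> 0" using pq by (simp_all add: e_def f_def)
  then have "e \<noteq> 0" "f \<noteq> 0" by auto
  ultimately show thesis using that by blast
qed

text \<open>Jacobi's identity: the 2 by 2 minors of the adjugate are, up to sign, entries of
  \<open>Y\<close> times \<open>det Y\<close>. So the adjugate of a singular matrix has rank at most
  one.\<close>

lemma minors_adj3:
  assumes "det Y = 0"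
  shows "adj3 Y $i$j * adj3 Y $k$l = adj3 Y $i$l * adj3 Y $k$j"
proof -
  have m: "adj3 Y $1$1 * adj3 Y $2$2 = adj3 Y $1$2 * adj3 Y $2$1 + det Y * Y$3$3"
    "adj3 Y $1$1 * adj3 Y $2$3 = adj3 Y $1$3 * adj3 Y $2$1 - det Y * Y$2$3"
    "adj3 Y $1$2 * adj3 Y $2$3 = adj3 Y $1$3 * adj3 Y $2$2 + det Y * Y$1$3"
    "adj3 Y $1$1 * adj3 Y $3$2 = adj3 Y $1$2 * adj3 Y $3$1 - det Y * Y$3$2"
    "adj3 Y $1$1 * adj3 Y $3$3 = adj3 Y $1$3 * adj3 Y $3$1 + det Y * Y$2$2"
    "adj3 Y $1$2 * adj3 Y $3$3 = adj3 Y $1$3 * adj3 Y $3$2 - det Y * Y$1$2"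
    "adj3 Y $2$1 * adj3 Y $3$2 = adj3 Y $2$2 * adj3 Y $3$1 + det Y * Y$3$1"
    "adj3 Y $2$1 * adj3 Y $3$3 = adj3 Y $2$3 * adj3 Y $3$1 - det Y * Y$2$1"
    "adj3 Y $2$2 * adj3 Y $3$3 = adj3 Y $2$3 * adj3 Y $3$2 + det Y * Y$1$1"
    by (simp_all add: adj3_def det_3 algebra_simps)
  show ?thesis
    using exhaust_3[of i] exhaust_3[of j] exhaust_3[of k] exhaust_3[of l] m[unfolded assms]
    by (elim disjE) (simp_all add: mult.commute)
qed

text \<open>The entries of the adjugate are, up to sign, the 2 by 2 minors of
  \<open>Y\<close>.\<close>

lemma minors_of_adj3_eq_0:
  assumes "adj3 Y = 0"
  shows "Y$i$j * Y$k$l = Y$i$l * Y$k$j"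
proof -
  have "adj3 Y $ p $ q = 0" for p q by (simp add: assms)
  from this[of 1 1] this[of 1 2] this[of 1 3] this[of 2 1] this[of 2 2] this[of 2 3]
    this[of 3 1] this[of 3 2] this[of 3 3]
  show ?thesis
    using exhaust_3[of i] exhaust_3[of j] exhaust_3[of k] exhaust_3[of l]
    by (elim disjE) (simp_all add: adj3_def mult.commute)
qed

text \<open>The inverse of an isometry is its adjoint, and passing to the adjoint conjugates the
  trace.\<close>

lemma trace_inverse_unitary:
  assumes A: "\<And>z w. herm (A *v z) (A *v w) = herm z w" and AB: "A ** B = mat 1"
  shows "trace B = cnj (trace A)"
proof -
  \<comment> \<open>The basis dual to the standard one under \<open>herm\<close> is the standard
    basis in reverse order.\<close>
  have tr: "trace M = herm (M *v axis 1 1) (axis 3 1) + herm (M *v axis 2 1) (axis 2 1)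
      + herm (M *v axis 3 1) (axis 1 1)" for M
    by (simp add: trace_def herm_def sum_3 matrix_vector_mult_def axis_def)
  have "herm (B *v z) w = cnj (herm (A *v w) z)" for z w
  proof -
    have "herm (B *v z) w = herm (A *v (B *v z)) (A *v w)" by (rule A[symmetric])
    also have "\<dots> = herm z (A *v w)" by (simp add: matrix_vector_mul_assoc AB)
    finally show ?thesis by (simp flip: herm_commute)
  qed
  then show ?thesis by (simp add: tr[of A] tr[of B])
qed

text \<open>With t the trace of \<open>A\<close>, the characteristic polynomial is X^3 - t X^2 + cnj
  t X - 1. It vanishes at 1 when t is real.\<close>

lemma det_minus_one_eq_0:
  assumes A: "\<And>z w. herm (A *v z) (A *v w) = herm z w" and det: "det A = 1"
    and real: "trace A \<in> \<real>"
  shows "det (A - mat 1) = 0"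
proof -
  have "A ** adj3 A = mat 1" by (simp add: mult_adj3 det)
  then have "trace (adj3 A) = cnj (trace A)" using trace_inverse_unitary A by blast
  also have "\<dots> = trace A" using real by (simp add: Reals_cnj_iff)
  finally have "trace (adj3 A) = trace A" .
  moreover have "det (A - mat 1) = det A - trace (adj3 A) + trace A - 1"
    by (simp add: det_3 adj3_def trace_def sum_3 mat_def algebra_simps)
  ultimately show ?thesis using det by simp
qed

section \<open>Real scalars and real spans of complex matrices\<close>

lemma scaleR_vec_complex: "r *\<^sub>R v = complex_of_real r *s v" for v :: "complex^'n"
  by (simp add: vec_eq_iff scaleR_conv_of_real[where 'a = complex])

lemma matrix_scaleR_mult:
  fixes A B :: "complex^3^3"
  shows "A ** (r *\<^sub>R B) = r *\<^sub>R (A ** B)" "(r *\<^sub>R A) ** B = r *\<^sub>R (A ** B)"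
  by (simp_all add: vec_eq_iff matrix_matrix_mult_def scaleR_sum_right)

lemma matrix_mult_add_rdistrib: "(A + B) ** C = A ** C + B ** C" for A B C :: "complex^3^3"
  by (simp add: vec_eq_iff matrix_matrix_mult_def sum.distrib distrib_right)

lemma matrix_scaleR_vec:
  fixes A :: "complex^3^3"
  shows "(r *\<^sub>R A) *v v = r *\<^sub>R (A *v v)" "A *v (r *\<^sub>R v) = r *\<^sub>R (A *v v)"
  by (simp_all add: vec_eq_iff matrix_vector_mult_def scaleR_sum_right)

lemma herm_scaleR: "herm (r *\<^sub>R u) w = of_real r * herm u w" "herm u (r *\<^sub>R w) = of_real r * herm u w"
  by (simp_all add: scaleR_vec_complex herm_linear)

lemma trace_scaleR: "trace (r *\<^sub>R M) = of_real r * trace M" for M :: "complex^'n^'n"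
  by (simp add: trace_def sum_distrib_left) (simp add: scaleR_conv_of_real)

lemma real_span_closed_linear:
  fixes N :: "(complex^3^3) set"
  assumes "\<And>B. B \<in> N \<Longrightarrow> f B \<in> span N" "\<And>A B. f (A + B) = f A + f B"
    "\<And>r A. f (r *\<^sub>R A) = r *\<^sub>R f A" "M \<in> span N"
  shows "f M \<in> span N"
proof -
  have "linear f" by (rule linearI) (use assms in auto)
  then have "f ` span N = span (f ` N)" by (simp add: linear_span_image)
  moreover have "span (f ` N) \<subseteq> span N"
    by (rule span_minimal) (use assms in auto)
  ultimately show ?thesis using assms(4) by blast
qed

lemma trace_span_real:
  fixes N :: "(complex^3^3) set"
  assumes "\<And>A. A \<in> N \<Longrightarrow> trace A \<in> \<real>" "M \<in> span N"
  shows "trace M \<in> \<real>"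
  using assms(2)
proof (induction rule: span_induct_alt)
  case base
  show ?case by (simp add: trace_def)
next
  case (step c x y)
  then show ?case by (simp add: trace_add trace_scaleR assms)
qed

text \<open>Since 1 is an eigenvalue of \<open>A\<close>, the matrix \<open>Y = A - mat 1\<close> is
  singular and its adjugate has rank at most one. If the adjugate vanishes, \<open>Y\<close> itself
  has rank one.\<close>

lemma exists_rank_one:
  assumes N: "subgroup N SU21" and real: "\<And>A. A \<in> N \<Longrightarrow> trace A \<in> \<real>"
    and A: "A \<in> N" "A \<noteq> mat 1"
  obtains e f where "e \<noteq> 0" "f \<noteq> 0" "(\<chi> i j. e$i * f$j) \<in> span N"
proof -
  define Y where "Y = A - mat 1"
  have one: "mat 1 \<in> N" and sq: "A ** A \<in> N" using A subgroup_SU21_facts[OF N] by blast+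
  have Y: "Y \<in> span N" unfolding Y_def using A one by (intro span_diff span_base)
  have YY: "Y ** Y = A ** A - A - A + mat 1"
    by (simp add: Y_def vec_eq_iff forall_3 matrix_matrix_mult_def sum_3 mat_def algebra_simps)
  have YY': "Y ** Y \<in> span N"
    unfolding YY using A one sq by (intro span_diff span_add span_base)
  have dY: "det Y = 0"
    unfolding Y_def
    by (rule det_minus_one_eq_0[OF subgroup_SU21_facts(3)[OF N A(1)]
        subgroup_SU21_facts(4)[OF N A(1)] real[OF A(1)]])
  have "trace Y \<in> \<real>" "trace (Y ** Y) \<in> \<real>"
    using trace_span_real[OF real] Y YY' by blast+
  then obtain t s where ts: "trace Y = of_real t" "trace (Y ** Y) = of_real s"
    by (auto elim!: Reals_cases)
  have "adj3 Y = Y ** Y - t *\<^sub>R Y + ((t^2 - s) / 2) *\<^sub>R mat 1"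
    using adj3_eq[of Y]
    by (simp add: vec_eq_iff ts scaleR_conv_of_real[where 'a = complex]) (simp add: field_simps)
  then have adj: "adj3 Y \<in> span N"
    using Y YY' one by (auto intro!: span_add span_diff span_scale intro: span_base)
  have "Y \<noteq> 0" using A by (simp add: Y_def)
  show thesis
  proof (cases "adj3 Y = 0")
    case True
    obtain e f where "e \<noteq> 0" "f \<noteq> 0" "Y = (\<chi> i j. e$i * f$j)"
      by (rule rank_one_of_minors[OF \<open>Y \<noteq> 0\<close> minors_of_adj3_eq_0[OF True]])
    then show ?thesis using that[of e f] Y by simp
  next
    case False
    obtain e f where "e \<noteq> 0" "f \<noteq> 0" "adj3 Y = (\<chi> i j. e$i * f$j)"
      by (rule rank_one_of_minors[OF False minors_adj3[OF dY]])
    then show ?thesis using that[of e f] adj by simp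
  qed
qed


section \<open>The invariant real form\<close>

text \<open>Let \<open>E\<close> be the rank-one matrix in the span of \<open>N\<close>, with image
  spanned by \<open>e\<close>. Real traces of \<open>A ** E\<close> say that the orbit of
  \<open>e\<close> has real pairings with a fixed vector \<open>\<phi>\<close>, so the real span of
  the orbit contains no complex line. The adjoint of \<open>E\<close> then transfers reality to the
  form itself, first up to a constant \<open>\<kappa>\<close>.\<close>

lemma real_form:
  assumes N: "subgroup N SU21" and irr: "\<And>v. \<not> common_eigenvector N v"
    and real: "\<And>A. A \<in> N \<Longrightarrow> trace A \<in> \<real>"
    and G: "subgroup \<Gamma> SU21" and norm: "\<And>A C. A \<in> N \<Longrightarrow> C \<in> \<Gamma> \<Longrightarrow> \<exists>B\<in>N. C ** A = B ** C"
  obtains V0 :: "(complex^3) set" where "subspace V0"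
    "\<forall>x\<in>V0. \<forall>y\<in>V0. herm x y \<in> \<real>"
    "\<forall>z. \<exists>x\<in>V0. \<exists>y\<in>V0. z = x + \<i> *s y"
    "\<forall>C\<in>\<Gamma>. \<exists>c. c \<noteq> 0 \<and> (\<forall>x\<in>V0. c *s (C *v x) \<in> V0)"
proof -
  have "\<exists>A\<in>N. A \<noteq> mat 1"
  proof (rule ccontr)
    assume "\<not> ?thesis"
    then have one: "A = mat 1" if "A \<in> N" for A using that by blast
    have "\<exists>c. A *v axis 1 1 = c *s axis 1 1" if "A \<in> N" for A
      unfolding one[OF that] by (rule exI[of _ 1]) simp
    then have "common_eigenvector N (axis 1 1)" by (simp add: common_eigenvector_def)
    then show False using irr[of "axis 1 1"] by contradiction
  qed
  then obtain A where A: "A \<in> N" "A \<noteq> mat 1" by blast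
  obtain e f where ef: "e \<noteq> 0" "f \<noteq> 0" and E: "(\<chi> i j. e$i * f$j) \<in> span N"
    by (rule exists_rank_one[OF N real A])
  define E where "E = (\<chi> i j. e$i * f$j)"
  \<comment> \<open>\<open>\<phi>\<close> represents the linear form with coefficients
    \<open>f\<close> through \<open>herm\<close>, which reverses the order and conjugates.\<close>
  define \<phi> :: "complex^3" where "\<phi> = vector [cnj (f$3), cnj (f$2), cnj (f$1)]"
  have EN: "E \<in> span N" using E by (simp add: E_def)
  have \<phi>0: "\<phi> \<noteq> 0" using ef(2) by (auto simp: \<phi>_def complex3_eq_iff)
  have Ez: "E *v z = herm z \<phi> *s e" for z
    by (simp add: E_def \<phi>_def herm_def vec_eq_iff matrix_vector_mult_def sum_3 algebra_simps)
  have trE: "trace (M ** E) = herm (M *v e) \<phi>" for M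
    by (simp add: E_def \<phi>_def herm_def trace_def matrix_matrix_mult_def matrix_vector_mult_def
        sum_3 algebra_simps)
  \<comment> \<open>\<open>span\<close> is the span over the reals, in contrast to the complex
    \<open>vec.span\<close>.\<close>
  define V0 where "V0 = span ((\<lambda>A. A *v e) ` N)"
  have sub: "subspace V0" by (simp add: V0_def)
  have gen: "A *v e \<in> V0" if "A \<in> N" for A
    unfolding V0_def using that by (intro span_base) blast
  have V0I: "P x" if "x \<in> V0" "P 0" "\<And>A. A \<in> N \<Longrightarrow> P (A *v e)"
      "\<And>x y. P x \<Longrightarrow> P y \<Longrightarrow> P (x + y)" "\<And>r x. P x \<Longrightarrow> P (r *\<^sub>R x)" for P x
    using that(1) unfolding V0_def
    by (induction rule: span_induct_alt) (use that in auto)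
  have e0: "e \<in> V0" using gen[OF subgroup_SU21_facts(1)[OF N]] by simp
  have N_V0: "A *v x \<in> V0" if "A \<in> N" "x \<in> V0" for A x
    using that(2)
  proof (rule V0I)
    show "A *v (B *v e) \<in> V0" if "B \<in> N" for B
      using gen[OF subgroup_SU21_facts(2)[OF N \<open>A \<in> N\<close> that]] by (simp add: matrix_vector_mul_assoc)
  qed (auto simp: matrix_vector_right_distrib matrix_scaleR_vec subspace_add[OF sub]
      subspace_scale[OF sub] subspace_0[OF sub])
  have span_V0: "M *v x \<in> V0" if "M \<in> span N" "x \<in> V0" for M x
    using that(1)
    by (induction rule: span_induct_alt)
      (simp_all add: matrix_vector_mult_add_rdistrib matrix_scaleR_vec subspace_add[OF sub]
      subspace_scale[OF sub] subspace_0[OF sub] N_V0 that)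
  have V0_\<phi>: "herm x \<phi> \<in> \<real>" if "x \<in> V0" for x
    using that
  proof (rule V0I)
    fix A assume A: "A \<in> N"
    have "A ** E \<in> span N"
    proof (rule real_span_closed_linear[OF _ _ _ EN])
      show "A ** B \<in> span N" if "B \<in> N" for B
        using subgroup_SU21_facts(2)[OF N A that] by (rule span_base)
    qed (simp_all add: matrix_add_ldistrib matrix_scaleR_mult)
    then show "herm (A *v e) \<phi> \<in> \<real>" using trace_span_real[OF real] trE by metis
  qed (simp_all add: herm_linear herm_scaleR)
  \<comment> \<open>For each \<open>A\<close> in \<open>N\<close> the pairing of
    \<open>A *v x\<close> with \<open>\<phi>\<close> and its product with \<open>\<i>\<close> would
    both be real, hence zero, which irreducibility excludes.\<close>
  have V0_i: "x = 0" if x: "x \<in> V0" "\<i> *s x \<in> V0" for x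
  proof (rule ccontr)
    assume "x \<noteq> 0"
    then obtain A where A: "A \<in> N" "herm (A *v x) \<phi> \<noteq> 0"
      using orbit_not_perp[OF N irr _ \<phi>0] by blast
    have "herm (A *v x) \<phi> \<in> \<real>" "herm (A *v (\<i> *s x)) \<phi> \<in> \<real>"
      using A(1) x N_V0 V0_\<phi> by blast+
    then show False
      using A(2) by (auto simp: vec.scale herm_linear complex_is_Real_iff complex_eq_iff)
  qed
  obtain P Q where PQ: "P \<in> N" "Q \<in> N" "herm (P *v e) (hcross e (Q *v e)) \<noteq> 0"
    using orbit_basis[OF N irr ef(1)] .
  \<comment> \<open>Three orbit vectors form a complex basis; the coordinates are split into real
    and imaginary parts.\<close>
  have decomp: "\<exists>x\<in>V0. \<exists>y\<in>V0. z = x + \<i> *s y" for z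
  proof -
    obtain a b c where z: "z = a *s (P *v e) + b *s e + c *s (Q *v e)"
      using basis_coordinates[OF PQ(3)] .
    define x where "x g = g a *\<^sub>R (P *v e) + g b *\<^sub>R e + g c *\<^sub>R (Q *v e)" for g :: "complex \<Rightarrow> real"
    have "x g \<in> V0" for g
      unfolding x_def using gen PQ e0 by (intro subspace_add[OF sub] subspace_scale[OF sub]) auto
    moreover have "z = x Re + \<i> *s x Im"
      unfolding z x_def scaleR_vec_complex
      by (subst (1 2 3) complex_eq) (simp add: complex3_eq_iff algebra_simps)
    ultimately show ?thesis by blast
  qed
  \<comment> \<open>\<open>E'\<close> is the adjoint of \<open>E\<close>. It lies in the span of
    \<open>N\<close> because the adjoints of elements of \<open>N\<close> are their inverses, again
    in \<open>N\<close>.\<close>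
  obtain E' where E': "E' \<in> span N" "\<And>z w. herm (E *v z) w = herm z (E' *v w)"
  proof -
    have "\<exists>M'\<in>span N. \<forall>z w. herm (M *v z) w = herm z (M' *v w)" if "M \<in> span N" for M
      using that
    proof (induction rule: span_induct_alt)
      case base
      show ?case by (intro bexI[of _ 0]) (simp_all add: herm_linear span_zero)
    next
      case (step r A M)
      obtain B where B: "B \<in> N" "A ** B = mat 1" using subgroup_SU21_inverse[OF N step(1)] by metis
      have "herm (A *v z) w = herm z (B *v w)" for z w
        using subgroup_SU21_facts(3)[OF N step(1), of z "B *v w"] by (simp add: matrix_vector_mul_assoc B)
      moreover obtain M' where "M' \<in> span N" "\<forall>z w. herm (M *v z) w = herm z (M' *v w)"
        using step(2) by blast
      ultimately show ?case using B(1)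
        by (intro bexI[of _ "r *\<^sub>R B + M'"])
          (simp_all add: matrix_vector_mult_add_rdistrib matrix_scaleR_vec herm_linear herm_scaleR
            span_add span_scale span_base)
    qed
    then show thesis using EN that by blast
  qed
  have E'w: "E' *v w = herm w e *s \<phi>" for w
  proof -
    have "herm (E' *v w - herm w e *s \<phi>) z = 0" for z
    proof -
      have "herm z (E' *v w - herm w e *s \<phi>) = herm (E *v z) w - cnj (herm w e) * herm z \<phi>"
        by (simp add: herm_linear E')
      also have "\<dots> = 0" by (simp add: Ez herm_linear flip: herm_commute)
      finally show ?thesis by (simp add: herm_eq_0_commute[of z])
    qed
    then show ?thesis using herm_nondegenerate[of "E' *v w - herm w e *s \<phi>"] by simp
  qed
  \<comment> \<open>All multiples of \<open>\<phi>\<close> in \<open>V0\<close> are real multiples of each other, and \<open>E'\<close> maps \<open>x\<close> to \<open>herm x e *s \<phi>\<close>.\<close>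
  obtain \<kappa> where \<kappa>: "\<kappa> \<noteq> 0" "\<And>x. x \<in> V0 \<Longrightarrow> herm x e / \<kappa> \<in> \<real>"
  proof -
    obtain A where A: "A \<in> N" "herm (A *v e) e \<noteq> 0" using orbit_not_perp[OF N irr ef(1) ef(1)] by blast
    define \<kappa> where "\<kappa> = herm (A *v e) e"
    define \<psi> where "\<psi> = \<kappa> *s \<phi>"
    have \<kappa>0: "\<kappa> \<noteq> 0" using A by (simp add: \<kappa>_def)
    have \<psi>: "\<psi> \<in> V0" "\<psi> \<noteq> 0"
      using span_V0[OF E'(1) gen[OF A(1)]] \<phi>0 \<kappa>0 by (simp_all add: E'w \<psi>_def \<kappa>_def)
    have "herm x e / \<kappa> \<in> \<real>" if "x \<in> V0" for x
    proof -
      define s where "s = herm x e / \<kappa>"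
      have "s *s \<psi> \<in> V0"
        using span_V0[OF E'(1) that] \<kappa>0 by (simp add: E'w s_def \<psi>_def)
      then have "s *s \<psi> - Re s *\<^sub>R \<psi> \<in> V0"
        using \<psi>(1) by (intro subspace_diff[OF sub] subspace_scale[OF sub])
      also have "s *s \<psi> - Re s *\<^sub>R \<psi> = \<i> *s (Im s *\<^sub>R \<psi>)"
        unfolding scaleR_vec_complex
        by (subst (1) complex_eq) (simp add: complex3_eq_iff algebra_simps)
      finally have "Im s *\<^sub>R \<psi> = 0" using V0_i[of "Im s *\<^sub>R \<psi>"] \<psi>(1) subspace_scale[OF sub] by blast
      then have "Im s = 0" using \<psi>(2) by simp
      then show ?thesis by (simp add: s_def complex_is_Real_iff)
    qed
    then show thesis using that \<kappa>0 by blast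
  qed
  \<comment> \<open>Invariance of the form under \<open>N\<close> carries the claim from the second
    argument \<open>e\<close> to its whole orbit.\<close>
  have V0_\<kappa>: "herm x y / \<kappa> \<in> \<real>" if x: "x \<in> V0" and y: "y \<in> V0" for x y
    using y
  proof (rule V0I)
    fix A assume A: "A \<in> N"
    obtain B where B: "B \<in> N" "A ** B = mat 1" using subgroup_SU21_inverse[OF N A] by metis
    have "herm x (A *v e) = herm (A *v (B *v x)) (A *v e)" by (simp add: matrix_vector_mul_assoc B)
    also have "\<dots> = herm (B *v x) e" by (rule subgroup_SU21_facts(3)[OF N A])
    finally show "herm x (A *v e) / \<kappa> \<in> \<real>" using \<kappa>(2) N_V0 B(1) x by metis
  next
    fix r y assume "herm x y / \<kappa> \<in> \<real>"
    then have "of_real r * (herm x y / \<kappa>) \<in> \<real>" by (intro Reals_mult) auto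
    then show "herm x (r *\<^sub>R y) / \<kappa> \<in> \<real>" by (simp add: herm_scaleR)
  qed (simp_all add: herm_linear add_divide_distrib)
  \<comment> \<open>Otherwise the form would be \<open>\<kappa>\<close> times a real alternating form on a 3-dimensional space,
    which is degenerate; \<open>u\<close> below spans its kernel.\<close>
  have "\<exists>x\<in>V0. herm x x \<noteq> 0"
  proof (rule ccontr)
    assume "\<not> ?thesis"
    then have null: "herm x x = 0" if "x \<in> V0" for x using that by blast
    have anti: "herm y x = - herm x y" if "x \<in> V0" "y \<in> V0" for x y
      using null[OF subspace_add[OF sub that]] null that by (simp add: herm_linear eq_neg_iff_add_eq_0)
    define v1 where "v1 = P *v e"
    define v3 where "v3 = Q *v e"
    have v: "v1 \<in> V0" "e \<in> V0" "v3 \<in> V0" using gen PQ e0 by (simp_all add: v1_def v3_def)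
    obtain r where r: "herm e v3 / \<kappa> = of_real r" using V0_\<kappa>[OF v(2,3)] by (auto elim: Reals_cases)
    obtain s where s: "herm v3 v1 / \<kappa> = of_real s" using V0_\<kappa>[OF v(3,1)] by (auto elim: Reals_cases)
    obtain t where t: "herm v1 e / \<kappa> = of_real t" using V0_\<kappa>[OF v(1,2)] by (auto elim: Reals_cases)
    have h: "herm e v3 = of_real r * \<kappa>" "herm v3 v1 = of_real s * \<kappa>" "herm v1 e = of_real t * \<kappa>"
      using r s t \<kappa>(1) by (simp_all add: field_simps)
    have h': "herm v3 e = - of_real r * \<kappa>" "herm v1 v3 = - of_real s * \<kappa>" "herm e v1 = - of_real t * \<kappa>"
      using anti[OF v(2,3)] anti[OF v(3,1)] anti[OF v(1,2)] by (simp_all add: h)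
    define u where "u = of_real r *s v1 + of_real s *s e + of_real t *s v3"
    have u: "herm v1 u = 0" "herm e u = 0" "herm v3 u = 0"
      using null v by (simp_all add: u_def herm_linear h h' algebra_simps)
    have b: "herm v1 (hcross e v3) \<noteq> 0" using PQ by (simp add: v1_def v3_def)
    have z: "w = 0" if "herm v1 w = 0" "herm e w = 0" "herm v3 w = 0" for w
    proof (rule herm_nondegenerate)
      fix z
      obtain k l m where "z = k *s v1 + l *s e + m *s v3" using basis_coordinates[OF b] .
      then show "herm w z = 0" using that by (simp add: herm_linear herm_eq_0_commute[of _ w])
    qed
    from z[OF u] have "u = 0" .
    then have "r = 0" "s = 0" "t = 0"
      using basis_independent[OF b, of "of_real r" "of_real s" "of_real t"] by (simp_all add: u_def)
    then have "v1 = 0" using z[of v1] h h' null[OF v(1)] by simp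
    then show False using basis_pairwise[OF b] by blast
  qed
  then obtain x where x: "x \<in> V0" "herm x x \<noteq> 0" by blast
  have "\<kappa> = herm x x / (herm x x / \<kappa>)" using x by simp
  also have "\<dots> \<in> \<real>" by (rule Reals_divide[OF herm_self_real V0_\<kappa>[OF x(1) x(1)]])
  finally have \<kappa>r: "\<kappa> \<in> \<real>" .
  have herm_V0: "herm x y \<in> \<real>" if "x \<in> V0" "y \<in> V0" for x y
    using Reals_mult[OF V0_\<kappa>[OF that] \<kappa>r] \<kappa>(1) by simp
  have "\<exists>c. c \<noteq> 0 \<and> (\<forall>x\<in>V0. c *s (C *v x) \<in> V0)" if C: "C \<in> \<Gamma>" for C
  proof -
    obtain D where D: "D \<in> \<Gamma>" "C ** D = mat 1" "D ** C = mat 1" using subgroup_SU21_inverse[OF G C] .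
    \<comment> \<open>The conjugate of \<open>E\<close> still lies in the span of \<open>N\<close>, and its image is spanned by \<open>C *v e\<close>.\<close>
    have "C ** E ** D \<in> span N"
    proof (rule real_span_closed_linear[OF _ _ _ EN])
      fix A assume "A \<in> N"
      then obtain B where "B \<in> N" "C ** A = B ** C" using norm C by blast
      then show "C ** A ** D \<in> span N" using D(2) by (simp add: span_base flip: matrix_mul_assoc)
    qed (simp_all add: matrix_add_ldistrib matrix_mult_add_rdistrib matrix_scaleR_mult)
    moreover obtain A where A: "A \<in> N" "herm (A *v e) (C *v \<phi>) \<noteq> 0"
      using orbit_not_perp[OF N irr ef(1) subgroup_SU21_vec_nonzero[OF G C \<phi>0]] by blast
    \<comment> \<open>The conjugate matrix sends \<open>A *v e\<close> to
      \<open>c *s (C *v e)\<close>. The choice of \<open>A\<close> makes \<open>c\<close> nonzero,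
      and this \<open>c\<close> is the factor wanted for \<open>C\<close>; normality extends it from
      \<open>e\<close> to the orbit.\<close>
    define c where "c = herm (D *v (A *v e)) \<phi>"
    have "c = herm (C *v (D *v (A *v e))) (C *v \<phi>)"
      unfolding c_def by (rule subgroup_SU21_facts(3)[OF G C, symmetric])
    then have c0: "c \<noteq> 0" using A(2) by (simp add: matrix_vector_mul_assoc D matrix_mul_assoc)
    have "(C ** E ** D) *v (A *v e) = c *s (C *v e)"
      by (simp add: c_def Ez vec.scale flip: matrix_vector_mul_assoc)
    ultimately have Ce: "c *s (C *v e) \<in> V0" using span_V0 gen[OF A(1)] by metis
    have "c *s (C *v x) \<in> V0" if "x \<in> V0" for x
      using that
    proof (rule V0I)
      fix A assume "A \<in> N"
      then obtain B where B: "B \<in> N" "C ** A = B ** C" using norm C by blast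
      have "c *s (C *v (A *v e)) = B *v (c *s (C *v e))"
        by (simp add: matrix_vector_mul_assoc B(2)) (simp add: vec.scale flip: matrix_vector_mul_assoc)
      then show "c *s (C *v (A *v e)) \<in> V0" using N_V0[OF B(1) Ce] by simp
    next
      fix r x assume "c *s (C *v x) \<in> V0"
      then have "r *\<^sub>R (c *s (C *v x)) \<in> V0" by (rule subspace_scale[OF sub])
      then show "c *s (C *v (r *\<^sub>R x)) \<in> V0"
        by (simp add: matrix_scaleR_vec) (simp add: scaleR_vec_complex mult.commute)
    qed (simp_all add: matrix_vector_right_distrib vec.scale_right_distrib subspace_add[OF sub]
        subspace_0[OF sub])
    then show ?thesis using c0 by blast
  qed
  then show thesis using that[OF sub] herm_V0 decomp by blast
qed

section \<open>Moving a real form to the standard one by an isometry\<close>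

definition real_vectors :: "(complex^3) set" where
  "real_vectors = {v. \<forall>i. v$i \<in> \<real>}"

text \<open>Gram-Schmidt, starting from a negative vector. The coefficients are values of the form
  on \<open>V0\<close>, hence real, so the process stays inside \<open>V0\<close>.\<close>

lemma orthonormal_frame:
  assumes sub: "subspace V0" and real: "\<And>x y. x \<in> V0 \<Longrightarrow> y \<in> V0 \<Longrightarrow> herm x y \<in> \<real>"
    and decomp: "\<And>z. \<exists>x\<in>V0. \<exists>y\<in>V0. z = x + \<i> *s y"
  obtains x y z where "x \<in> V0" "y \<in> V0" "z \<in> V0" "herm x x = -1" "herm y y = 1" "herm z z = 1"
    "herm x y = 0" "herm x z = 0" "herm y z = 0"
proof -
  have scale: "c *s v \<in> V0" if "c \<in> \<real>" "v \<in> V0" for c v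
    using that subspace_scale[OF sub] by (metis Reals_cases scaleR_vec_complex)
  have test: "\<exists>w\<in>V0. herm w n \<noteq> 0" if "n \<noteq> 0" for n
  proof (rule ccontr)
    assume "\<not> ?thesis"
    then have 0: "herm w n = 0" if "w \<in> V0" for w using that by blast
    have "herm n z = 0" for z
    proof -
      obtain a b where "a \<in> V0" "b \<in> V0" "z = a + \<i> *s b" using decomp by blast
      then have "herm z n = 0" using 0 by (simp add: herm_linear)
      then show ?thesis by (simp add: herm_eq_0_commute[of z])
    qed
    then show False using herm_nondegenerate that by blast
  qed
  have normalise: "\<exists>u\<in>V0. herm u u = of_real (sgn (Re (herm v v))) \<and> (\<forall>w. herm w v = 0 \<longrightarrow> herm w u = 0)"
    if v: "v \<in> V0" "Re (herm v v) \<noteq> 0" for v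
  proof -
    define r where "r = 1 / sqrt \<bar>Re (herm v v)\<bar>"
    have "r * r * Re (herm v v) = sgn (Re (herm v v))"
      using v(2) by (simp add: r_def sgn_if field_simps)
    moreover have "herm (r *\<^sub>R v) (r *\<^sub>R v) = of_real (r * r * Re (herm v v))"
      using herm_self_eq[of v] by (simp add: herm_scaleR)
    ultimately have "herm (r *\<^sub>R v) (r *\<^sub>R v) = of_real (sgn (Re (herm v v)))" by simp
    moreover have "herm w (r *\<^sub>R v) = 0" if "herm w v = 0" for w using that by (simp add: herm_scaleR)
    ultimately show ?thesis using subspace_scale[OF sub v(1)] by blast
  qed
  obtain x where x: "x \<in> V0" "herm x x = -1"
  proof -
    \<comment> \<open>The mixed terms cancel because \<open>herm a b\<close> is real, so
      \<open>a\<close> or \<open>b\<close> must be negative.\<close>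
    obtain a b where ab: "a \<in> V0" "b \<in> V0" "vector [1, 0, -1] = a + \<i> *s b" using decomp by blast
    have "herm b a = herm a b"
      using real[OF ab(1,2)] herm_commute[of b a] by (simp add: Reals_cnj_iff)
    then have "herm (vector [1, 0, -1]) (vector [1, 0, -1]) = herm a a + herm b b"
      unfolding ab(3) by (simp add: herm_linear algebra_simps)
    then have "Re (herm a a) + Re (herm b b) < 0" using exists_negative by simp
    then obtain v where "v \<in> V0" "Re (herm v v) < 0" using ab by (metis add_nonneg_nonneg not_less)
    then show thesis using normalise[of v] that by (auto simp: sgn_if)
  qed
  have x0: "x \<noteq> 0" using x by (auto simp: herm_linear)
  have "\<exists>n. n \<noteq> 0 \<and> herm x n = 0"
  proof (rule ccontr)
    assume "\<not> ?thesis"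
    then have "hcross x a = 0" for a by (metis herm_hcross_same(1))
    then have "\<exists>c. a = c *s x" for a using hcross_eq_0_imp_dependent[OF _ x0] by blast
    then obtain c d where "axis 1 1 = c *s x" "axis 2 1 = d *s x" by metis
    then show False by (auto simp: complex3_eq_iff axis_def)
  qed
  then obtain n where n: "n \<noteq> 0" "herm x n = 0" by blast
  obtain y where y: "y \<in> V0" "herm y y = 1" "herm x y = 0"
  proof -
    obtain w where w: "w \<in> V0" "herm w n \<noteq> 0" using test n(1) by blast
    \<comment> \<open>The sign is plus because \<open>herm x x = -1\<close>. Adding a multiple of
      \<open>x\<close> leaves the pairing with \<open>n\<close> unchanged, which shows that
      \<open>v\<close> is nonzero; \<open>hcross x y\<close> plays the part of \<open>n\<close> for
      the third vector.\<close>
    define v where "v = w + herm w x *s x"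
    have "herm v n \<noteq> 0" using w n by (simp add: v_def herm_linear)
    then have "v \<noteq> 0" by (auto simp: herm_linear)
    moreover have vx: "herm v x = 0" by (simp add: v_def herm_linear x)
    ultimately have "Re (herm v v) > 0" using positive_of_perp_negative[of x v] x by simp
    moreover have "v \<in> V0" unfolding v_def using w x real by (intro subspace_add[OF sub] scale)
    ultimately obtain u where "u \<in> V0" "herm u u = 1" "\<forall>w. herm w v = 0 \<longrightarrow> herm w u = 0"
      using normalise[of v] by auto
      moreover have "herm x v = 0" using vx by (simp add: herm_eq_0_commute[of v])
    ultimately show thesis using that by blast
  qed
  have yx: "herm y x = 0" using y(3) by (simp add: herm_eq_0_commute[of x])
  have "hcross x y \<noteq> 0"
  proof
    assume "hcross x y = 0"
    then obtain c where "y = c *s x" using hcross_eq_0_imp_dependent x0 by blast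
    then show False using yx y(2) x by (simp add: herm_linear)
  qed
  then obtain w where w: "w \<in> V0" "herm w (hcross x y) \<noteq> 0" using test by blast
  define v where "v = w + herm w x *s x - herm w y *s y"
  have "herm v (hcross x y) \<noteq> 0" using w by (simp add: v_def herm_linear)
  then have "v \<noteq> 0" by (auto simp: herm_linear)
  moreover have vx: "herm v x = 0" by (simp add: v_def herm_linear x yx)
  ultimately have "Re (herm v v) > 0" using positive_of_perp_negative[of x v] x by simp
  moreover have vy: "herm v y = 0" by (simp add: v_def herm_linear y)
  moreover have "v \<in> V0"
    unfolding v_def using w x y real by (intro subspace_add[OF sub] subspace_diff[OF sub] scale)
  ultimately obtain u where "u \<in> V0" "herm u u = 1" "\<forall>w. herm w v = 0 \<longrightarrow> herm w u = 0"
    using normalise[of v] by auto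
  moreover have "herm x v = 0" "herm y v = 0" using vx vy by (simp_all add: herm_eq_0_commute[of v])
  ultimately show thesis using that[OF x(1) y(1) _ x(2) y(2)] y(3) by blast
qed

lemma real_form_frame:
  assumes sub: "subspace V0" and real: "\<And>x y. x \<in> V0 \<Longrightarrow> y \<in> V0 \<Longrightarrow> herm x y \<in> \<real>"
    and decomp: "\<And>z. \<exists>x\<in>V0. \<exists>y\<in>V0. z = x + \<i> *s y"
  obtains B where "B \<in> carrier U21" "V0 = (*v) B ` real_vectors"
proof -
  obtain x y z where V: "x \<in> V0" "y \<in> V0" "z \<in> V0" and h: "herm x x = -1" "herm y y = 1"
    "herm z z = 1" "herm x y = 0" "herm x z = 0" "herm y z = 0"
    using orthonormal_frame[OF sub real decomp] by metis
  have h': "herm y x = 0" "herm z x = 0" "herm z y = 0" using h herm_eq_0_commute by metis+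
  \<comment> \<open>The isotropic vectors \<open>u\<close> and \<open>w\<close> have pairing 1, so
    \<open>u\<close>, \<open>z\<close>, \<open>w\<close> have the same Gram matrix as the standard
    basis and are the columns of an isometry \<open>B\<close>.\<close>
  define u where "u = x + y"
  define w where "w = (1/2) *s (y - x)"
  have half: "(1/2) *s v = (1/2::real) *\<^sub>R v" for v :: "complex^3" by (simp add: scaleR_vec_complex)
  have uw: "u \<in> V0" "w \<in> V0"
    unfolding u_def w_def half using V by (auto intro!: subspace_add[OF sub] subspace_scale[OF sub] subspace_diff[OF sub])
  have g: "herm u u = 0" "herm w w = 0" "herm u w = 1" "herm w u = 1" "herm z u = 0" "herm u z = 0"
    "herm z w = 0" "herm w z = 0"
    by (simp_all add: u_def w_def herm_linear h h')
  define B :: "complex^3^3" where "B = (\<chi> i j. if j = 1 then u$i else if j = 2 then z$i else w$i)"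
  have Bv: "B *v v = v$1 *s u + v$2 *s z + v$3 *s w" for v
    by (simp add: B_def vec_eq_iff matrix_vector_mult_def sum_3)
  have B: "B \<in> carrier U21"
    unfolding carrier_U21
  proof (intro allI)
    fix a b
    show "herm (B *v a) (B *v b) = herm a b"
      unfolding herm_def[of a b] by (simp add: Bv herm_linear g h algebra_simps)
  qed
  interpret group U21 by (rule group_U21)
  have "inv\<^bsub>U21\<^esub> B \<in> carrier U21" "B ** inv\<^bsub>U21\<^esub> B = mat 1" using B r_inv[OF B] by simp_all
  then obtain D where D: "B ** D = mat 1" by blast
  have "V0 = (*v) B ` real_vectors"
  proof
    show "V0 \<subseteq> (*v) B ` real_vectors"
    proof
      fix v assume v: "v \<in> V0"
      have BD: "B *v (D *v v) = v" by (simp add: matrix_vector_mul_assoc D)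
      define c where "c = D *v v"
      have "v = c$1 *s u + c$2 *s z + c$3 *s w" unfolding Bv[symmetric] c_def BD ..
      then have "herm v w = c$1" "herm v z = c$2" "herm v u = c$3" by (simp_all add: herm_linear g h)
      then have "c$1 \<in> \<real>" "c$2 \<in> \<real>" "c$3 \<in> \<real>" using real[OF v] uw V by metis+
      then have "c \<in> real_vectors" by (simp add: real_vectors_def forall_3)
      then show "v \<in> (*v) B ` real_vectors" using BD c_def by (metis imageI)
    qed
    show "(*v) B ` real_vectors \<subseteq> V0"
    proof
      fix v assume "v \<in> (*v) B ` real_vectors"
      then obtain c where c: "v = B *v c" "\<And>i. c$i \<in> \<real>" by (auto simp: real_vectors_def)
      then have ca: "c$i *s a = Re (c$i) *\<^sub>R a" for i a by (simp add: scaleR_vec_complex)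
      have "v = Re (c$1) *\<^sub>R u + Re (c$2) *\<^sub>R z + Re (c$3) *\<^sub>R w"
        unfolding c(1) Bv by (simp only: ca)
      then show "v \<in> V0"
        using uw V by (simp add: subspace_add[OF sub] subspace_scale[OF sub])
    qed
  qed
  then show thesis using that B by blast
qed

section \<open>Totally real planes and lifts to SU(2,1)\<close>

lemma image_span_singleton: "(*v) A ` vec.span {v} = vec.span {A *v v}"
  by (auto simp: vec.span_singleton vec.scale image_iff)

lemma span_singleton_scale:
  assumes "c \<noteq> 0"
  shows "vec.span {c *s v} = vec.span {v :: complex^3}"
proof -
  have "(\<exists>k. x = k *s (c *s v)) \<longleftrightarrow> (\<exists>k. x = k *s v)" for x
  proof
    assume "\<exists>k. x = k *s v"
    then obtain k where "x = k *s v" ..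
    then have "x = (k / c) *s (c *s v)" using assms by simp
    then show "\<exists>k. x = k *s (c *s v)" ..
  qed auto
  then show ?thesis unfolding vec.span_singleton by blast
qed

lemma PU21_act_span:
  assumes "v \<noteq> 0"
  shows "PU21_act (PU21_class A) (vec.span {v}) = vec.span {A *v v}"
  using PU21_act_class[of "vec.span {v}" A] assms by (auto simp: CP2_def image_span_singleton)

lemma Re_herm_neg_nonzero: "Re (herm v v) < 0 \<Longrightarrow> v \<noteq> 0"
  by (auto simp: herm_linear)

text \<open>In the definition the real and the negative representative of the line may differ. They
  agree up to a nonzero complex factor, which scales the form by a positive number.\<close>

lemma std_real_plane_iff:
  "L \<in> std_real_plane \<longleftrightarrow> (\<exists>v\<in>real_vectors. Re (herm v v) < 0 \<and> L = vec.span {v})"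
proof
  assume "L \<in> std_real_plane"
  then obtain v w where v: "v \<noteq> 0" "v \<in> real_vectors" "L = vec.span {v}"
    and w: "Re (herm w w) < 0" "L = vec.span {w}"
    by (auto simp: std_real_plane_def H2C_def real_vectors_def)
  have "w \<in> vec.span {v}" using v w vec.span_superset by blast
  then obtain c where "w = c *s v" by (auto simp: vec.span_singleton)
  then have "herm w w = of_real (cmod c ^ 2) * herm v v"
    by (simp add: herm_linear complex_norm_square del: of_real_power)
  then have "cmod c ^ 2 * Re (herm v v) < 0" using w(1) by simp
  then have "Re (herm v v) < 0" by (simp add: mult_less_0_iff)
  then show "\<exists>v\<in>real_vectors. Re (herm v v) < 0 \<and> L = vec.span {v}" using v by blast
next
  assume "\<exists>v\<in>real_vectors. Re (herm v v) < 0 \<and> L = vec.span {v}"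
  then show "L \<in> std_real_plane"
    unfolding std_real_plane_def H2C_def using Re_herm_neg_nonzero
    by (fastforce simp: real_vectors_def)
qed

lemma image_std_real_plane_iff:
  "L \<in> PU21_act (PU21_class B) ` std_real_plane \<longleftrightarrow>
    (\<exists>v\<in>real_vectors. Re (herm v v) < 0 \<and> L = vec.span {B *v v})"
proof -
  have eq: "std_real_plane = (\<lambda>v. vec.span {v}) ` {v \<in> real_vectors. Re (herm v v) < 0}"
    by (auto simp: std_real_plane_iff)
  show ?thesis
    unfolding eq image_image using PU21_act_span[OF Re_herm_neg_nonzero] by (auto simp: image_iff)
qed

lemma subgroup_SU21_lift:
  assumes "subgroup G PU21"
  shows "subgroup (SU21_lift G) SU21"
proof -
  interpret S: group SU21 by (rule group_SU21)
  have "PU21_class \<in> hom SU21 PU21"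
    using normal.r_coset_hom_Mod[OF normal_U21_scalars]
    by (auto simp: hom_def PU21_def PU21_class_def SU21_def)
  then interpret group_hom SU21 PU21 PU21_class
    by (simp add: group_hom_def group_hom_axioms_def group_SU21 group_PU21)
  show ?thesis
  proof (rule S.subgroupI)
    show "SU21_lift G \<noteq> {}"
      using subgroup.one_closed[OF assms] hom_one S.one_closed unfolding SU21_lift_def by force
  next
    fix A assume "A \<in> SU21_lift G"
    then show "inv\<^bsub>SU21\<^esub> A \<in> SU21_lift G"
      using subgroup.m_inv_closed[OF assms] by (simp add: SU21_lift_def)
  next
    fix A B assume "A \<in> SU21_lift G" "B \<in> SU21_lift G"
    then show "A \<otimes>\<^bsub>SU21\<^esub> B \<in> SU21_lift G"
      using subgroup.m_closed[OF assms] hom_mult S.m_closed unfolding SU21_lift_def by auto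
  qed (auto simp: SU21_lift_def)
qed

lemma SU21_lift_representative:
  assumes "subgroup G PU21" "g \<in> G"
  obtains A where "A \<in> SU21_lift G" "g = PU21_class A"
proof -
  have "g \<in> PU21_class ` carrier SU21" using subgroup.mem_carrier[OF assms] PU21_class_surj by simp
  then show thesis using that assms(2) by (auto simp: SU21_lift_def)
qed

lemma reducible_of_common_eigenvector:
  assumes G: "subgroup G PU21" and v: "common_eigenvector (SU21_lift G) v"
  shows "reducible_PU21 G"
  unfolding reducible_PU21_def
proof (intro bexI ballI)
  have v0: "v \<noteq> 0" using v by (simp add: common_eigenvector_def)
  then show "vec.span {v} \<in> CP2" by (auto simp: CP2_def)
  fix g assume "g \<in> G"
  then obtain A where A: "A \<in> SU21_lift G" "g = PU21_class A" using SU21_lift_representative[OF G] by blast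
  obtain c where c: "A *v v = c *s v" using v A(1) by (auto simp: common_eigenvector_def)
  have "A *v v \<noteq> 0" using subgroup_SU21_vec_nonzero[OF subgroup_SU21_lift[OF G] A(1) v0] .
  then have "c \<noteq> 0" using c by auto
  then show "PU21_act g (vec.span {v}) = vec.span {v}"
    by (simp add: A(2) PU21_act_span[OF v0] c span_singleton_scale)
qed

section \<open>The normal subgroup generated by cubes, and its trace field\<close>

lemma SU21_cube: "A [^]\<^bsub>SU21\<^esub> (3::nat) = A ** A ** A"
  by (simp add: numeral_3_eq_3 nat_pow_def)

lemma cubes_in_carrier:
  assumes "subgroup \<Gamma> SU21"
  shows "(\<lambda>A. A [^]\<^bsub>SU21\<^esub> (3::nat)) ` \<Gamma> \<subseteq> carrier SU21"
proof -
  interpret group SU21 by (rule group_SU21)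
  show ?thesis using subgroup.mem_carrier[OF assms] by auto
qed

lemma subgroup_cube_subgroup:
  assumes "subgroup \<Gamma> SU21"
  shows "subgroup (cube_subgroup \<Gamma>) SU21"
  unfolding cube_subgroup_def
  by (rule group.generate_is_subgroup[OF group_SU21 cubes_in_carrier[OF assms]])

lemma intertwine_inverse:
  fixes A B C :: "'a::semiring_1^'n^'n"
  assumes "B' ** B = mat 1" "A ** A' = mat 1" "B ** C = C ** A"
  shows "C ** A' = B' ** C"
proof -
  have "C ** A' = B' ** B ** C ** A'" by (simp add: assms)
  also have "\<dots> = B' ** (B ** C) ** A'" by (simp only: matrix_mul_assoc)
  also have "\<dots> = B' ** C ** (A ** A')" by (simp only: assms(3) matrix_mul_assoc)
  also have "\<dots> = B' ** C" by (simp add: assms)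
  finally show ?thesis .
qed

text \<open>The conjugate of a cube is the cube of the conjugate; the induction extends this to
  inverses and products.\<close>

lemma cube_subgroup_normal:
  assumes G: "subgroup \<Gamma> SU21" and C: "C \<in> \<Gamma>" and A: "A \<in> cube_subgroup \<Gamma>"
  shows "\<exists>B\<in>cube_subgroup \<Gamma>. C ** A = B ** C"
  using A unfolding cube_subgroup_def
proof (induction rule: generate.induct)
  case one
  show ?case by (rule bexI[OF _ generate.one]) simp
next
  case (incl h)
  then obtain D where D: "D \<in> \<Gamma>" "h = D ** D ** D" by (auto simp: SU21_cube)
  obtain C' where C': "C' \<in> \<Gamma>" "C ** C' = mat 1" "C' ** C = mat 1" using subgroup_SU21_inverse[OF G C] .
  define F where "F = C ** D ** C'"
  have "F \<in> \<Gamma>" unfolding F_def using C C' D by (auto intro!: subgroup_SU21_facts[OF G])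
  moreover have "F ** C = C ** D" by (simp add: F_def C' flip: matrix_mul_assoc)
  then have "F ** F ** F ** C = C ** h"
    by (metis D(2) matrix_mul_assoc)
  ultimately show ?case
    by (intro bexI[OF _ generate.incl[of "F ** F ** F"]]) (auto simp: SU21_cube)
next
  case (inv h)
  then obtain D where D: "D \<in> \<Gamma>" "h = D ** D ** D" by (auto simp: SU21_cube)
  interpret group SU21 by (rule group_SU21)
  have hc: "h \<in> carrier SU21" using inv cubes_in_carrier[OF G] by blast
  obtain C' where C': "C' \<in> \<Gamma>" "C ** C' = mat 1" "C' ** C = mat 1" using subgroup_SU21_inverse[OF G C] .
  define F where "F = C ** D ** C'"
  have F: "F \<in> \<Gamma>" unfolding F_def using C C' D by (auto intro!: subgroup_SU21_facts[OF G])
  have "F ** C = C ** D" by (simp add: F_def C' flip: matrix_mul_assoc)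
  then have Fh: "F ** F ** F ** C = C ** h"
    by (metis D(2) matrix_mul_assoc)
  have Fc: "F ** F ** F \<in> (\<lambda>A. A [^]\<^bsub>SU21\<^esub> (3::nat)) ` \<Gamma>" using F by (auto simp: SU21_cube)
  then have "F ** F ** F \<in> carrier SU21" using cubes_in_carrier[OF G] by blast
  then have "inv\<^bsub>SU21\<^esub> (F ** F ** F) ** (F ** F ** F) = mat 1" using l_inv by fastforce
  moreover have "h ** inv\<^bsub>SU21\<^esub> h = mat 1" using r_inv[OF hc] by simp
  ultimately have "C ** inv\<^bsub>SU21\<^esub> h = inv\<^bsub>SU21\<^esub> (F ** F ** F) ** C"
    using Fh by (rule intertwine_inverse)
  then show ?case by (rule bexI[OF _ generate.inv[OF Fc]])
next
  case (eng h1 h2)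
  then obtain B1 B2 where B: "B1 \<in> generate SU21 ((\<lambda>A. A [^]\<^bsub>SU21\<^esub> (3::nat)) ` \<Gamma>)" "C ** h1 = B1 ** C"
    "B2 \<in> generate SU21 ((\<lambda>A. A [^]\<^bsub>SU21\<^esub> (3::nat)) ` \<Gamma>)" "C ** h2 = B2 ** C" by blast
  have "C ** (h1 ** h2) = B1 ** (C ** h2)" by (simp only: B(2) matrix_mul_assoc)
  also have "\<dots> = B1 ** B2 ** C" by (simp only: B(4) matrix_mul_assoc)
  finally show ?case by (intro bexI[OF _ generate.eng[OF B(1,3)]]) simp
qed

text \<open>The reals are a subfield of the complex numbers, so it suffices to look at the
  generators.\<close>

lemma trace_field_real_iff: "trace_field \<Gamma> \<subseteq> \<real> \<longleftrightarrow> (\<forall>A\<in>\<Gamma>. trace A \<in> \<real>)"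
proof
  assume "trace_field \<Gamma> \<subseteq> \<real>"
  moreover have "trace A \<in> trace_field \<Gamma>" if "A \<in> \<Gamma>" for A
    using that by (simp add: trace_field_def generate_field.incl)
  ultimately show "\<forall>A\<in>\<Gamma>. trace A \<in> \<real>" by blast
next
  assume r: "\<forall>A\<in>\<Gamma>. trace A \<in> \<real>"
  interpret field "ring_of_type_algebra :: complex ring" by (rule field_from_type_algebra)
  have "x \<in> \<real>" if "x \<in> trace_field \<Gamma>" for x
    using that unfolding trace_field_def
  proof (induction rule: generate_field.induct)
    case (a_inv h)
    have "\<ominus>\<^bsub>ring_of_type_algebra\<^esub> h = - h"
      by (rule minus_equality) (simp_all add: ring_of_type_algebra_def)
    then show ?case using a_inv by simp
  next
    case (m_inv h)
    have "inv\<^bsub>ring_of_type_algebra\<^esub> h = inverse h"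
      by (rule comm_inv_char) (use m_inv in \<open>simp_all add: ring_of_type_algebra_def\<close>)
    then show ?case using m_inv by simp
  qed (use r in \<open>auto simp: ring_of_type_algebra_def\<close>)
  then show "trace_field \<Gamma> \<subseteq> \<real>" by blast
qed

section \<open>Both directions of the equivalence\<close>

text \<open>\<open>M\<close> sends a basis of real negative vectors to multiples of real vectors,
  and the multipliers have real ratios. So \<open>M\<close> is a scalar \<open>c1\<close> times a
  real matrix \<open>R\<close>; determinant 1 makes \<open>c1 ^ 3\<close> real, and this is the
  scalar in front of the cube of \<open>R\<close>.\<close>

lemma cube_of_projectively_real:
  assumes M: "M \<in> carrier U21" and det: "det M = 1"
    and pres: "\<And>v. v \<in> real_vectors \<Longrightarrow> Re (herm v v) < 0 \<Longrightarrow> \<exists>c. \<exists>w\<in>real_vectors. M *v v = c *s w"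
  shows "(M ** M ** M) $ i $ j \<in> \<real>"
proof -
  have herm_real: "herm v w \<in> \<real>" if "v \<in> real_vectors" "w \<in> real_vectors" for v w
    using that by (auto simp: real_vectors_def herm_def Reals_cnj_iff intro!: Reals_add Reals_mult)
  \<comment> \<open>Three independent real negative vectors, all with nonzero pairing with
    \<open>n1\<close>, from which the standard basis is an integral combination.\<close>
  define n1 :: "complex^3" where "n1 = vector [1, 0, -1]"
  define n2 :: "complex^3" where "n2 = vector [2, 0, -1]"
  define n3 :: "complex^3" where "n3 = vector [1, 1, -1]"
  have n: "n1 \<in> real_vectors" "n2 \<in> real_vectors" "n3 \<in> real_vectors"
    by (simp_all add: n1_def n2_def n3_def real_vectors_def forall_3)
  have h: "herm n1 n1 = -2" "herm n2 n2 = -4" "herm n3 n3 = -1" "herm n2 n1 = -3" "herm n3 n1 = -2"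
    by (simp_all add: n1_def n2_def n3_def herm_def)
  obtain c1 r1 where 1: "r1 \<in> real_vectors" "M *v n1 = c1 *s r1" using pres[OF n(1)] h by auto
  obtain c2 r2 where 2: "r2 \<in> real_vectors" "M *v n2 = c2 *s r2" using pres[OF n(2)] h by auto
  obtain c3 r3 where 3: "r3 \<in> real_vectors" "M *v n3 = c3 *s r3" using pres[OF n(3)] h by auto
  have U: "herm (M *v z) (M *v w) = herm z w" for z w using M by (simp add: carrier_U21)
  have c1: "c1 \<noteq> 0"
  proof
    assume "c1 = 0"
    then show False using U[of n1 n1] by (simp add: 1 h herm_linear)
  qed
  \<comment> \<open>The pairing \<open>herm v n1\<close> is \<open>c * cnj c1\<close> times the real
    number \<open>herm r r1\<close>; dividing \<open>c * cnj c1\<close> by the squared modulus of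
    \<open>c1\<close> gives the ratio.\<close>
  have ratio: "c / c1 \<in> \<real>"
    if r: "r \<in> real_vectors" "M *v v = c *s r" and v: "herm v n1 \<in> \<real>" "herm v n1 \<noteq> 0" for c r v
  proof -
    have e: "c * cnj c1 * herm r r1 = herm v n1" using U[of v n1] by (simp add: 1 r herm_linear ac_simps)
    moreover have "herm r r1 \<noteq> 0" using e v(2) by auto
    ultimately have "c * cnj c1 = herm v n1 / herm r r1" by (simp add: eq_divide_eq)
    then have "c * cnj c1 \<in> \<real>" using Reals_divide[OF v(1) herm_real[OF r(1) 1(1)]] by simp
    moreover have "c / c1 = (c * cnj c1) / of_real (cmod c1 ^ 2)"
      using c1 by (simp only: complex_norm_square) simp
    ultimately show ?thesis by (simp only: Reals_divide Reals_of_real)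
  qed
  define R where "R = (\<chi> i j. M $ i $ j / c1)"
  have RM: "R *v v = (1 / c1) *s (M *v v)" for v
    by (simp add: R_def vec_eq_iff matrix_vector_mult_def sum_3 field_simps c1)
  have Rr: "(R *v v) $ i \<in> \<real>"
    if "r \<in> real_vectors" "M *v v = c *s r" "herm v n1 \<in> \<real>" "herm v n1 \<noteq> 0" for c r v i
    using ratio[OF that] that(1) Reals_mult[of "c / c1" "r $ i"] by (simp add: RM that(2) real_vectors_def)
  have Rn: "(R *v n1) $ i \<in> \<real>" "(R *v n2) $ i \<in> \<real>" "(R *v n3) $ i \<in> \<real>" for i
    by (rule Rr[OF 1] Rr[OF 2] Rr[OF 3]; simp add: h)+
  have "R $ i $ 1 = (R *v n2) $ i - (R *v n1) $ i" "R $ i $ 3 = (R *v n2) $ i - 2 * (R *v n1) $ i"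
    "R $ i $ 2 = (R *v n3) $ i - (R *v n1) $ i" for i
    by (simp_all add: n1_def n2_def n3_def matrix_vector_mult_def sum_3)
  then have R13: "R $ i $ 1 \<in> \<real>" "R $ i $ 2 \<in> \<real>" "R $ i $ 3 \<in> \<real>" for i
    using Rn by (auto intro!: Reals_diff Reals_mult)
  have R: "R $ i $ j \<in> \<real>" for i j using exhaust_3[of j] R13[of i] by auto
  have Mij: "M $ i $ j = c1 * R $ i $ j" for i j by (simp add: R_def c1)
  have "det M = c1 ^ 3 * det R" by (simp add: det_3 Mij power3_eq_cube algebra_simps)
  then have "c1 ^ 3 = 1 / det R" using det by (metis mult_zero_right nonzero_eq_divide_eq zero_neq_one)
  moreover have "det R \<in> \<real>" by (auto simp: det_3 intro!: R Reals_add Reals_mult Reals_diff)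
  ultimately have c3r: "c1 ^ 3 \<in> \<real>" by simp
  have "(M ** M ** M) $ i $ j = c1 ^ 3 * (R ** R ** R) $ i $ j"
    by (simp add: matrix_matrix_mult_def sum_3 Mij power3_eq_cube algebra_simps)
  moreover have "(R ** R ** R) $ i $ j \<in> \<real>"
    by (auto simp: matrix_matrix_mult_def intro!: R sum_in_Reals Reals_mult)
  ultimately show ?thesis using c3r by simp
qed

text \<open>Conjugation by \<open>B\<close> moves the plane to the standard one. There cubes are
  real matrices, hence so are all products of cubes and their inverses, and conjugation preserves
  traces.\<close>

lemma R_subgroup_imp_real_traces:
  assumes "R_subgroup G" and A: "A \<in> cube_subgroup (SU21_lift G)"
  shows "trace A \<in> \<real>"
proof -
  interpret U: group U21 by (rule group_U21)
  interpret S: group SU21 by (rule group_SU21)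
  obtain P where G: "subgroup G PU21" and P: "totally_real_plane P" "\<And>g. g \<in> G \<Longrightarrow> PU21_act g ` P = P"
    using assms(1) unfolding R_subgroup_def by blast
  obtain B where B: "B \<in> carrier U21" "P = PU21_act (PU21_class B) ` std_real_plane"
    using P(1) unfolding totally_real_plane_def carrier_PU21 by blast
  define B' where "B' = inv\<^bsub>U21\<^esub> B"
  have B': "B' \<in> carrier U21" "B' ** B = mat 1" "B ** B' = mat 1"
    using B(1) U.l_inv[OF B(1)] U.r_inv[OF B(1)] by (simp_all add: B'_def)
  have BB: "B ** (B' ** M) = M" "B' ** (B ** M) = M" for M by (simp_all add: matrix_mul_assoc B')
  have G': "subgroup (SU21_lift G) SU21" by (rule subgroup_SU21_lift[OF G])
  have cube: "(B' ** (D ** D ** D) ** B) $ i $ j \<in> \<real>" if D: "D \<in> SU21_lift G" for D i j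
  proof -
    define M where "M = B' ** D ** B"
    have DU: "D \<in> carrier U21" and DG: "PU21_class D \<in> G" using D by (auto simp: SU21_lift_def SU21_def)
    have MU: "M \<in> carrier U21" using U.m_closed[OF U.m_closed[OF B'(1) DU] B(1)] by (simp add: M_def)
    have "det B' * det B = 1" by (metis B'(2) det_mul det_I)
    then have "det M = 1"
      by (simp add: M_def det_mul subgroup_SU21_facts(4)[OF G' D])
    moreover have "\<exists>c. \<exists>w\<in>real_vectors. M *v v = c *s w"
      if v: "v \<in> real_vectors" "Re (herm v v) < 0" for v
    proof -
      have "Re (herm (B *v v) (B *v v)) < 0" using v(2) B(1) by (simp add: carrier_U21)
      then have Bv: "B *v v \<noteq> 0" by (rule Re_herm_neg_nonzero)
      have "vec.span {B *v v} \<in> P" unfolding B(2) image_std_real_plane_iff using v by blast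
      then have "PU21_act (PU21_class D) (vec.span {B *v v}) \<in> P" using P(2)[OF DG] by blast
      then have "vec.span {D *v (B *v v)} \<in> P" by (simp add: PU21_act_span[OF Bv])
      then obtain w where w: "w \<in> real_vectors" "vec.span {D *v (B *v v)} = vec.span {B *v w}"
        unfolding B(2) image_std_real_plane_iff by blast
      then have "D *v (B *v v) \<in> vec.span {B *v w}" using vec.span_superset by blast
      then obtain c where "D *v (B *v v) = c *s (B *v w)" by (auto simp: vec.span_singleton)
      then have "B' *v (D *v (B *v v)) = c *s (B' *v (B *v w))" by (simp add: vec.scale)
      then have "M *v v = c *s w" by (simp add: M_def matrix_vector_mul_assoc B' matrix_mul_assoc)
      then show ?thesis using w(1) by blast
    qed
    ultimately have "(M ** M ** M) $ i $ j \<in> \<real>" using cube_of_projectively_real[OF MU] by blast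
    moreover have "M ** M ** M = B' ** (D ** D ** D) ** B"
      by (simp add: M_def BB flip: matrix_mul_assoc)
    ultimately show ?thesis by simp
  qed
  have "(B' ** A ** B) $ i $ j \<in> \<real>" for i j
    using A unfolding cube_subgroup_def
  proof (induction arbitrary: i j rule: generate.induct)
    case one
    have "B' ** mat 1 ** B = mat 1" by (simp add: B')
    then show ?case by (simp add: mat_def)
  next
    case (incl h)
    then show ?case using cube by (auto simp: SU21_cube)
  next
    \<comment> \<open>The inverse of a cube is the cube of the inverse, which lies in the lift as
      well.\<close>
    case (inv h)
    then obtain D where D: "D \<in> SU21_lift G" "h = D [^]\<^bsub>SU21\<^esub> (3::nat)" by blast
    have "D \<in> carrier SU21" using D by (simp add: SU21_lift_def)
    then have "inv\<^bsub>SU21\<^esub> h = inv\<^bsub>SU21\<^esub> D ** inv\<^bsub>SU21\<^esub> D ** inv\<^bsub>SU21\<^esub> D"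
      by (simp add: D(2) S.nat_pow_inv flip: SU21_cube)
    then show ?case using cube[OF subgroup.m_inv_closed[OF G' D(1)]] by simp
  next
    case (eng h1 h2)
    have "B' ** (h1 ** h2) ** B = (B' ** h1 ** B) ** (B' ** h2 ** B)"
      by (simp add: BB flip: matrix_mul_assoc)
    then show ?case using eng.IH
      by (simp add: matrix_matrix_mult_def[of "B' ** h1 ** B"] sum_in_Reals)
  qed
  then have "trace (B' ** A ** B) \<in> \<real>" by (simp add: trace_def sum_in_Reals)
  also have "trace (B' ** A ** B) = trace A"
    by (subst trace_mul_sym) (simp add: BB)
  finally show ?thesis .
qed

lemma real_traces_imp_R_subgroup:
  assumes G: "subgroup G PU21" and irr: "\<not> reducible_PU21 G"
    and real: "\<And>A. A \<in> cube_subgroup (SU21_lift G) \<Longrightarrow> trace A \<in> \<real>"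
  shows "R_subgroup G"
proof -
  define \<Gamma> where "\<Gamma> = SU21_lift G"
  define N where "N = cube_subgroup \<Gamma>"
  have \<Gamma>: "subgroup \<Gamma> SU21" unfolding \<Gamma>_def by (rule subgroup_SU21_lift[OF G])
  have N: "subgroup N SU21" unfolding N_def by (rule subgroup_cube_subgroup[OF \<Gamma>])
  have irr\<Gamma>: "\<not> common_eigenvector \<Gamma> v" for v
    using reducible_of_common_eigenvector[OF G] irr unfolding \<Gamma>_def by blast
  have norm: "\<exists>B\<in>N. C ** A = B ** C" if "A \<in> N" "C \<in> \<Gamma>" for A C
    using cube_subgroup_normal[OF \<Gamma>] that unfolding N_def by blast
  have realN: "trace A \<in> \<real>" if "A \<in> N" for A using real that by (simp add: N_def \<Gamma>_def)
  \<comment> \<open>With a common eigenvector \<open>N\<close> would be scalar by Clifford theory. A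
    scalar matrix of determinant 1 with real trace is the identity, so all cubes in
    \<open>\<Gamma>\<close> would be trivial and \<open>\<Gamma>\<close> reducible.\<close>
  have irrN: "\<not> common_eigenvector N v" for v
  proof
    assume v: "common_eigenvector N v"
    have norm': "\<exists>B\<in>N. A ** C = C ** B" if A: "A \<in> N" and C: "C \<in> \<Gamma>" for A C
    proof -
      obtain C' where C': "C' \<in> \<Gamma>" "C ** C' = mat 1" "C' ** C = mat 1" using subgroup_SU21_inverse[OF \<Gamma> C] .
      then obtain B where B: "B \<in> N" "C' ** A = B ** C'" using norm A by blast
      have "A ** C = C ** (C' ** A) ** C" by (simp add: matrix_mul_assoc C')
      also have "\<dots> = C ** B" by (simp add: B C' flip: matrix_mul_assoc)
      finally show ?thesis using B(1) by blast
    qed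
    have one: "A = mat 1" if A: "A \<in> N" for A
    proof -
      obtain c where c: "A = mat c"
        using clifford_scalar[OF \<Gamma> irr\<Gamma> subgroup_SU21_facts(3)[OF N] norm' v A] by blast
      have "3 * c \<in> \<real>" using realN[OF A] by (simp add: c trace_def sum_3 mat_def)
      then have "c \<in> \<real>" by (simp add: complex_is_Real_iff)
      then obtain r where r: "c = of_real r" by (rule Reals_cases)
      have "c ^ 3 = 1"
        using subgroup_SU21_facts(4)[OF N A] by (simp add: c det_3 mat_def power3_eq_cube)
      then have "complex_of_real (r ^ 3) = 1" by (simp add: r)
      then have "r ^ 3 = 1" by (simp only: of_real_eq_1_iff)
      moreover have "(r - 1) * (r^2 + r + 1) = r ^ 3 - 1"
        by (simp add: power2_eq_square power3_eq_cube algebra_simps)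
      moreover have "r^2 + r + 1 > 0"
        using zero_le_power2[of "r + 1/2"] by (simp add: power2_sum power_divide)
      ultimately have "r = 1" by simp
      then show ?thesis using c r by simp
    qed
    have "D ** D ** D = mat 1" if "D \<in> \<Gamma>" for D
      by (rule one) (use that in \<open>auto simp: N_def cube_subgroup_def simp flip: SU21_cube intro: generate.incl\<close>)
    then show False using exponent_3_reducible[OF \<Gamma>] irr\<Gamma> by blast
  qed
  obtain V0 where V0: "subspace V0" "\<forall>x\<in>V0. \<forall>y\<in>V0. herm x y \<in> \<real>"
    "\<forall>z. \<exists>x\<in>V0. \<exists>y\<in>V0. z = x + \<i> *s y"
    and stable: "\<forall>C\<in>\<Gamma>. \<exists>c. c \<noteq> 0 \<and> (\<forall>x\<in>V0. c *s (C *v x) \<in> V0)"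
    by (rule real_form[OF N irrN realN \<Gamma> norm])
  obtain B where B: "B \<in> carrier U21" "V0 = (*v) B ` real_vectors"
    using real_form_frame[OF V0(1)] V0(2,3) by blast
  define P where "P = PU21_act (PU21_class B) ` std_real_plane"
  \<comment> \<open>\<open>B\<close> preserves the form, so the plane consists of the lines through
    negative vectors of \<open>V0\<close>.\<close>
  have P_iff: "L \<in> P \<longleftrightarrow> (\<exists>x\<in>V0. Re (herm x x) < 0 \<and> L = vec.span {x})" for L
    using B(1) unfolding P_def image_std_real_plane_iff B(2) by (auto simp: carrier_U21)
  have invariant: "PU21_act (PU21_class A) L \<in> P" if A: "A \<in> \<Gamma>" and L: "L \<in> P" for A L
  proof -
    obtain x where x: "x \<in> V0" "Re (herm x x) < 0" "L = vec.span {x}" using L P_iff by blast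
    obtain c where c: "c \<noteq> 0" "c *s (A *v x) \<in> V0" using stable A x(1) by blast
    have "herm (c *s (A *v x)) (c *s (A *v x)) = of_real (cmod c ^ 2) * herm x x"
      by (simp add: herm_linear subgroup_SU21_facts(3)[OF \<Gamma> A] complex_norm_square del: of_real_power)
    then have "Re (herm (c *s (A *v x)) (c *s (A *v x))) = cmod c ^ 2 * Re (herm x x)" by simp
    also have "\<dots> < 0" using c(1) x(2) by (simp add: mult_pos_neg)
    finally have "vec.span {c *s (A *v x)} \<in> P" using c(2) P_iff by blast
    then show ?thesis
      by (simp add: x(3) PU21_act_span[OF Re_herm_neg_nonzero[OF x(2)]] span_singleton_scale[OF c(1)])
  qed
  have "PU21_act g ` P = P" if g: "g \<in> G" for g
  proof
    obtain A where A: "A \<in> \<Gamma>" "g = PU21_class A"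
      using SU21_lift_representative[OF G g] unfolding \<Gamma>_def .
    show "PU21_act g ` P \<subseteq> P" using invariant A by blast
    \<comment> \<open>Equality, and not only inclusion, comes from applying the invariance to the
      inverse \<open>D\<close>.\<close>
    obtain D where D: "D \<in> \<Gamma>" "A ** D = mat 1" using subgroup_SU21_inverse[OF \<Gamma> A(1)] .
    show "P \<subseteq> PU21_act g ` P"
    proof
      fix L assume L: "L \<in> P"
      then obtain x where x: "x \<noteq> 0" "L = vec.span {x}" using P_iff Re_herm_neg_nonzero by blast
      have "L = PU21_act g (PU21_act (PU21_class D) L)"
        using subgroup_SU21_vec_nonzero[OF \<Gamma> D(1) x(1)]
        by (simp add: x PU21_act_span A(2) matrix_vector_mul_assoc D)
      then show "L \<in> PU21_act g ` P" using invariant[OF D(1) L] by blast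
    qed
  qed
  moreover have "totally_real_plane P"
    unfolding totally_real_plane_def P_def carrier_PU21 using B(1) by blast
  ultimately show ?thesis using G unfolding R_subgroup_def by blast
qed

theorem theoremC:
  fixes G :: "(complex^3^3) set set"
  assumes "subgroup G PU21"
    and "discrete_in_PU21 G"
    and "\<not> reducible_PU21 G"
  shows "R_Fuchsian G \<longleftrightarrow> invariant_trace_field G \<subseteq> \<real>"
  using assms R_subgroup_imp_real_traces real_traces_imp_R_subgroup
  unfolding R_Fuchsian_def invariant_trace_field_def trace_field_real_iff by blast

end
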